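(* Consider the $n$-player stochastic game with separately controlled chains, local-information policies and team variance criterion $J^u_\sigma$ described in the context. There always exists a stationary deterministic policy $u^*=(u_1^*,\dots,u_n^* )\in\mathcal U^{\rm SD}$ that achieves the minimal team variance, i.e. $$J^{u^*}_\sigma = J^*_\sigma := \min_{u\in\mathcal U^{\rm HR}} J^u_\sigma ,$$ and this $u^*$ is also a stationary pure Nash equilibrium policy of the game, i.e. for every $i\in\mathcal I$ and every $u_i\in\mathcal U_i^{\rm HR}$, $$J^{u^*}_\sigma\le J^{(u_1^*,\dots,u_{i-1}^*,u_i,u_{i+1}^*,\dots,u_n^* )}_\sigma .$$
   Context: Game. There are players $\mathcal I=\{1,\dots,n\}$. Player $i$ has a finite state space $\mathcal S_i$ and a finite action space $\mathcal A_i$. Time is discrete, $t=0,1,2,\dots$; the joint state is $(s_{1,t},\dots,s_{n,t})$ and the joint action is $(a_{1,t},\dots,a_{n,t})$; the initial state is fixed. Separately controlled chains: player $i$'s state moves according to a transition probability $p_i(s_i'\mid s_i,a_i)$ depending only on its own state and action, player $i$'s reward is $r_i(s_i,a_i)\in\mathbb R$, and the joint transition probability is $\prod_{i=1}^n p_i(s_i'\mid s_i,a_i)$. Policies. Local observations: player $i$ observes only its own states, actions and rewards. Its local history at time $t$ is $h_{i,t}=(s_{i,0},a_{i,0},r_{i,0},\dots,s_{i,t-1},a_{i,t-1},r_{i,t-1},s_{i,t})$. A history-dependent randomized policy of player $i$ is a sequence $u_i=(u_{i,0},u_{i,1},\dots)$, where $u_{i,t}(\cdot\mid h_{i,t})$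 is a probability distribution on $\mathcal A_i$; the players randomize independently. A stationary deterministic policy of player $i$ is a map $u_i:\mathcal S_i\to\mathcal A_i$, with $a_{i,t}=u_i(s_{i,t})$. $\mathcal U_i^{\rm SD}$ is the set of stationary deterministic policies of player $i$ and $\mathcal U_i^{\rm HR}\supseteq\mathcal U_i^{\rm SD}$ is the set of its (admissible) history-dependent randomized policies; $\mathcal U^{\rm HR}=\times_{i=1}^n\mathcal U_i^{\rm HR}$ and $\mathcal U^{\rm SD}=\times_{i=1}^n\mathcal U_i^{\rm SD}$. Standing ergodicity assumption. For every $i$ and every $u_i\in\mathcal U_i^{\rm SD}$, the Markov chain on $\mathcal S_i$ with transition probabilities $p_i(s'\mid s,u_i(s))$ is ergodic (irreducible and aperiodic). $\mathcal U_i^{\rm HR}$ consists of the history-dependent randomized policies of player $i$ under which the limits as $T\to\infty$ of $\frac1T\sum_{t=0}^{T-1}r_i(s_{i,t},a_{i,t})$ and $\frac1T\sum_{t=0}^{T-1}r_i(s_{i,t},a_{i,t})^2$ exist almost surely. Criterion. For $u\in\mathcal U^{\rm HR}$ the team mean and team variance are $$\mu^u=\mathbb E^u\Big\{\frac1n\sum_{i=1}^n\lim_{T\to\infty}\frac1T\sum_{t=0}^{T-1}r_i(s_{i,t},a_{i,t})\Big\},\qquad J^u_\sigma=\mathbb E^u\Big\{\sum_{i=1}^n\lim_{T\to\infty}\frac1T\sum_{t=0}^{T-1}[r_i(s_{i,t},a_{i,t})-\mu^u]^2\Big\}.$$ All players share the common objective of minimizing $J^u_\sigma$. *)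

theory Defs
  imports "HOL-Probability.Probability"
begin

section \<open>Separately controlled games\<close>

text \<open>
  The players are the elements of a finite type \<open>'i\<close>, so that the number of players is
  \<open>CARD('i)\<close>.  The state and action spaces of the players are finite subsets of two common
  carrier types.
\<close>

record ('i, 's, 'a) game =
  states :: "'i \<Rightarrow> 's set"
  actions :: "'i \<Rightarrow> 'a set"
  transition :: "'i \<Rightarrow> 's \<Rightarrow> 'a \<Rightarrow> 's pmf"
  reward :: "'i \<Rightarrow> 's \<Rightarrow> 'a \<Rightarrow> real"
  init :: "'i \<Rightarrow> 's"

definition separately_controlled_game :: "('i::finite, 's, 'a) game \<Rightarrow> bool" where
  "separately_controlled_game G \<longleftrightarrow> (\<forall>i.
     finite (states G i) \<and> finite (actions G i) \<and> actions G i \<noteq> {} \<and> init G i \<in> states G i \<and>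
     (\<forall>s\<in>states G i. \<forall>a\<in>actions G i. set_pmf (transition G i s a) \<subseteq> states G i))"


section \<open>Ergodic finite chains\<close>

primrec nstep :: "('s \<Rightarrow> 's pmf) \<Rightarrow> nat \<Rightarrow> 's \<Rightarrow> 's pmf" where
  "nstep k 0 s = return_pmf s"
| "nstep k (Suc m) s = bind_pmf (nstep k m s) k"

definition irreducible_chain :: "'s set \<Rightarrow> ('s \<Rightarrow> 's pmf) \<Rightarrow> bool" where
  "irreducible_chain S k \<longleftrightarrow> (\<forall>s\<in>S. \<forall>s'\<in>S. \<exists>m. pmf (nstep k m s) s' > 0)"

definition aperiodic_chain :: "'s set \<Rightarrow> ('s \<Rightarrow> 's pmf) \<Rightarrow> bool" where
  "aperiodic_chain S k \<longleftrightarrow> (\<forall>s\<in>S. Gcd {m::nat. m > 0 \<and> pmf (nstep k m s) s > 0} = 1)"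

definition ergodic_chain :: "'s set \<Rightarrow> ('s \<Rightarrow> 's pmf) \<Rightarrow> bool" where
  "ergodic_chain S k \<longleftrightarrow> irreducible_chain S k \<and> aperiodic_chain S k"


section \<open>Law of a process with history-dependent transitions\<close>

text \<open>
  The law on infinite trajectories in \<open>X\<close> of the process whose next element is drawn from
  \<open>K [x 0, \<dots>, x (t - 1)]\<close>, obtained as the Ionescu-Tulcea limit.  It is meaningful
  when \<open>K\<close> maps lists over the finite set \<open>X\<close> to distributions supported in \<open>X\<close>; the
  restriction to \<open>X\<close> then only cuts the underlying space down to \<open>X\<close>.
\<close>

definition step_measure :: "'x set \<Rightarrow> ('x list \<Rightarrow> 'x pmf) \<Rightarrow> nat \<Rightarrow> (nat \<Rightarrow> 'x) \<Rightarrow> 'x measure" where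
  "step_measure X K t x = restrict_space (measure_pmf (K (map x [0..<t]))) X"

definition process_law :: "'x set \<Rightarrow> ('x list \<Rightarrow> 'x pmf) \<Rightarrow> (nat \<Rightarrow> 'x) measure" where
  "process_law X K =
     projective_family.lim UNIV
       (Ionescu_Tulcea.CI (step_measure X K) (\<lambda>_. count_space X)) (\<lambda>_. count_space X)"


section \<open>Policies\<close>

text \<open>
  A history-dependent randomized policy takes the list of the past (state, action, reward)
  triples of the player and its current state; the time is the length of the list.
\<close>

type_synonym ('s, 'a) policy = "('s \<times> 'a \<times> real) list \<Rightarrow> 's \<Rightarrow> 'a pmf"

definition observe :: "('i, 's, 'a) game \<Rightarrow> 'i \<Rightarrow> ('s \<times> 'a) list \<Rightarrow> ('s \<times> 'a \<times> real) list" where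
  "observe G i = map (\<lambda>(s, a). (s, a, reward G i s a))"

definition randomized_policy :: "('i, 's, 'a) game \<Rightarrow> 'i \<Rightarrow> ('s, 'a) policy \<Rightarrow> bool" where
  "randomized_policy G i v \<longleftrightarrow>
     (\<forall>h \<in> lists (states G i \<times> actions G i). \<forall>s \<in> states G i.
        set_pmf (v (observe G i h) s) \<subseteq> actions G i)"

text \<open>The law of the state-action process of player \<open>i\<close> alone under policy \<open>v\<close>.\<close>

definition player_step ::
  "('i, 's, 'a) game \<Rightarrow> 'i \<Rightarrow> ('s, 'a) policy \<Rightarrow> ('s \<times> 'a) list \<Rightarrow> ('s \<times> 'a) pmf" where
  "player_step G i v h =
     bind_pmf (if h = [] then return_pmf (init G i)
               else transition G i (fst (last h)) (snd (last h)))
       (\<lambda>s. bind_pmf (v (observe G i h) s) (\<lambda>a. return_pmf (s, a)))"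

definition player_law ::
  "('i, 's, 'a) game \<Rightarrow> 'i \<Rightarrow> ('s, 'a) policy \<Rightarrow> (nat \<Rightarrow> 's \<times> 'a) measure" where
  "player_law G i v = process_law (states G i \<times> actions G i) (player_step G i v)"

definition time_avg :: "(nat \<Rightarrow> real) \<Rightarrow> nat \<Rightarrow> real" where
  "time_avg f T = (\<Sum>t<T. f t) / real T"

definition HR :: "('i, 's, 'a) game \<Rightarrow> 'i \<Rightarrow> ('s, 'a) policy set" where
  "HR G i = {v. randomized_policy G i v \<and>
     (AE x in player_law G i v.
        convergent (time_avg (\<lambda>t. reward G i (fst (x t)) (snd (x t)))) \<and>
        convergent (time_avg (\<lambda>t. (reward G i (fst (x t)) (snd (x t)))\<^sup>2)))}"

definition HR_profiles :: "('i, 's, 'a) game \<Rightarrow> ('i \<Rightarrow> ('s, 'a) policy) set" where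
  "HR_profiles G = {u. \<forall>i. u i \<in> HR G i}"

definition SD :: "('i, 's, 'a) game \<Rightarrow> 'i \<Rightarrow> ('s \<Rightarrow> 'a) set" where
  "SD G i = (states G i \<rightarrow>\<^sub>E actions G i)"

definition stationary :: "('s \<Rightarrow> 'a) \<Rightarrow> ('s, 'a) policy" where
  "stationary d = (\<lambda>h s. return_pmf (d s))"

definition ergodic_game :: "('i, 's, 'a) game \<Rightarrow> bool" where
  "ergodic_game G \<longleftrightarrow>
     (\<forall>i. \<forall>d\<in>SD G i. ergodic_chain (states G i) (\<lambda>s. transition G i s (d s)))"


section \<open>The joint process and the team criteria\<close>

text \<open>
  Since \<open>Pi_pmf\<close> is taken over all of \<open>UNIV\<close>, its default value plays no role.
\<close>

definition joint_step ::
  "('i::finite, 's, 'a) game \<Rightarrow> ('i \<Rightarrow> ('s, 'a) policy) \<Rightarrow>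
     (('i \<Rightarrow> 's) \<times> ('i \<Rightarrow> 'a)) list \<Rightarrow> (('i \<Rightarrow> 's) \<times> ('i \<Rightarrow> 'a)) pmf" where
  "joint_step G u h =
     bind_pmf (if h = [] then return_pmf (init G)
               else Pi_pmf UNIV undefined
                      (\<lambda>i. transition G i (fst (last h) i) (snd (last h) i)))
       (\<lambda>s. bind_pmf
          (Pi_pmf UNIV undefined
             (\<lambda>i. u i (observe G i (map (\<lambda>(s, a). (s i, a i)) h)) (s i)))
          (\<lambda>a. return_pmf (s, a)))"

definition joint_law ::
  "('i::finite, 's, 'a) game \<Rightarrow> ('i \<Rightarrow> ('s, 'a) policy) \<Rightarrow>
     (nat \<Rightarrow> ('i \<Rightarrow> 's) \<times> ('i \<Rightarrow> 'a)) measure" where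
  "joint_law G u =
     process_law ({s. \<forall>i. s i \<in> states G i} \<times> {a. \<forall>i. a i \<in> actions G i}) (joint_step G u)"

definition reward_at ::
  "('i, 's, 'a) game \<Rightarrow> 'i \<Rightarrow> (nat \<Rightarrow> ('i \<Rightarrow> 's) \<times> ('i \<Rightarrow> 'a)) \<Rightarrow> nat \<Rightarrow> real" where
  "reward_at G i x t = reward G i (fst (x t) i) (snd (x t) i)"

definition team_mean :: "('i::finite, 's, 'a) game \<Rightarrow> ('i \<Rightarrow> ('s, 'a) policy) \<Rightarrow> real" where
  "team_mean G u =
     (\<integral>x. 1 / real CARD('i) * (\<Sum>i\<in>UNIV. lim (time_avg (reward_at G i x))) \<partial>joint_law G u)"

definition team_variance :: "('i::finite, 's, 'a) game \<Rightarrow> ('i \<Rightarrow> ('s, 'a) policy) \<Rightarrow> real" where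
  "team_variance G u =
     (\<integral>x. (\<Sum>i\<in>UNIV. lim (time_avg (\<lambda>t. (reward_at G i x t - team_mean G u)\<^sup>2))) \<partial>joint_law G u)"

definition nash_equilibrium :: "('i::finite, 's, 'a) game \<Rightarrow> ('i \<Rightarrow> ('s, 'a) policy) \<Rightarrow> bool" where
  "nash_equilibrium G u \<longleftrightarrow> u \<in> HR_profiles G \<and>
     (\<forall>i. \<forall>v\<in>HR G i. team_variance G u \<le> team_variance G (u(i := v)))"

end

theory Submission
  imports Defs
begin

text \<open>
  The team variance is awkward because its integrand contains the mean \<open>\<mu>\<^sup>u\<close> of the policy
  itself, so it is not an average cost.  The remedy is to centre the squares at a free constant
  \<open>c\<close>.  Write \<open>D u c\<close> for the expectation of the long-run averages of
  \<open>(r\<^sub>i - c)\<^sup>2\<close>, summed over the \<open>n\<close> players.  Expanding the square gives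
  \<open>D u c = J\<^sup>u + n (c - \<mu>\<^sup>u)\<^sup>2\<close> (\<open>dispersion_eq\<close>), so \<open>J\<^sup>u\<close> is the minimum of \<open>D u c\<close> over \<open>c\<close>,
  attained at \<open>c = \<mu>\<^sup>u\<close>.  For fixed \<open>c\<close> the players decouple: each one faces an average-cost
  Markov decision process with cost \<open>(r\<^sub>i - c)\<^sup>2\<close>, which some stationary deterministic rule
  \<open>d\<^sub>i\<close> solves (\<open>stationary_dispersion_minimal\<close>).  Hence, for an arbitrary admissible \<open>u\<close> and
  \<open>c = \<mu>\<^sup>u\<close>, some stationary deterministic profile \<open>d\<close> has
  \<open>J\<^sup>d \<le> D d c \<le> D u c = J\<^sup>u\<close>.  There are finitely many stationary deterministic profiles, so a
  best one among them is optimal among all admissible profiles; and a global optimum of a common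
  objective is a Nash equilibrium, since a unilateral deviation is again an admissible profile.

  The single-player problem is solved path by path.  Every stationary rule \<open>d\<close> has a Poisson
  equation \<open>g + h s = c s (d s) + (P\<^sub>d h) s\<close>; a policy improvement argument shows that, for the rule
  with the least gain \<open>g\<close>, the right-hand side cannot be lowered by any action
  (\<open>average_cost_optimality\<close>).  Under an arbitrary history-dependent policy the terms
  \<open>h (s\<^sub>t) - (P h) (s\<^sub>t, a\<^sub>t)\<close> telescope up to bounded martingale differences, so their time
  averages vanish almost surely by a strong law of large numbers (\<open>martingale_difference_slln\<close>).
  Therefore long-run average costs are almost surely at least \<open>g\<close>, with convergence to
  \<open>g\<close> under the optimal rule.  The same computation with the Poisson equations of the
  reward and of its square shows that stationary rules are admissible.

  The link to the joint process is that player \<open>i\<close>'s coordinate of the joint process has the law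
  of player \<open>i\<close>'s own process (\<open>joint_law_coord\<close>), which transports the almost sure statements.
\<close>

section \<open>Laws of history-dependent processes\<close>

primrec path_pmf :: "('x list \<Rightarrow> 'x pmf) \<Rightarrow> nat \<Rightarrow> 'x list pmf" where
  "path_pmf K 0 = return_pmf []"
| "path_pmf K (Suc n) = bind_pmf (path_pmf K n) (\<lambda>l. map_pmf (\<lambda>x. l @ [x]) (K l))"

text \<open>
  The processes whose law is a genuine Ionescu-Tulcea limit.  Over a finite \<open>X\<close> all subsets of the
  finite powers of \<open>X\<close> are measurable, so measurability of the transition kernels comes for free.
\<close>

locale history_process =
  fixes X :: "'x set" and K :: "'x list \<Rightarrow> 'x pmf"
  assumes finite_X: "finite X"
    and closed: "\<And>l. l \<in> lists X \<Longrightarrow> set_pmf (K l) \<subseteq> X"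
begin

lemma map_prefix_restrict: "map (restrict x {0..<n}) [0..<n] = map x [0..<n]"
  by (rule map_cong) auto

lemma map_prefix_upd: "map (x(n := y)) [0..<Suc n] = map x [0..<n] @ [y]"
proof -
  have "map (x(n := y)) [0..<n] = map x [0..<n]" by (rule map_cong) auto
  then show ?thesis by simp
qed

lemma set_path_pmf: "l \<in> set_pmf (path_pmf K n) \<Longrightarrow> l \<in> lists X \<and> length l = n"
proof (induction n arbitrary: l)
  case (Suc n)
  then obtain l' x where *: "l' \<in> set_pmf (path_pmf K n)" "x \<in> set_pmf (K l')" "l = l' @ [x]"
    by auto
  with Suc.IH[of l'] closed[of l'] show ?case by auto
qed simp

lemma PiM_finite_eq: "finite J \<Longrightarrow> PiM J (\<lambda>_. count_space X) = count_space (PiE J (\<lambda>_. X))"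
  using finite_X by (intro count_space_PiM_finite) (auto intro: countable_finite)

lemma step_measure_in_subprob:
  assumes "x \<in> {0..<t} \<rightarrow>\<^sub>E X"
  shows "step_measure X K t x \<in> space (subprob_algebra (count_space X))"
    and "prob_space (step_measure X K t x)"
proof -
  let ?p = "K (map x [0..<t])"
  have "map x [0..<t] \<in> lists X"
    using assms by (auto simp: PiE_iff)
  then have sub: "set_pmf ?p \<subseteq> X" by (rule closed)
  show p: "prob_space (step_measure X K t x)"
    unfolding step_measure_def
  proof (rule prob_spaceI)
    have "emeasure (measure_pmf ?p) X = 1"
      using sub by (simp add: emeasure_pmf measure_pmf.emeasure_eq_1_AE AE_measure_pmf_iff subset_iff)
    then show "emeasure (restrict_space (measure_pmf ?p) X)
        (space (restrict_space (measure_pmf ?p) X)) = 1"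
      by (simp add: emeasure_restrict_space space_restrict_space)
  qed
  show "step_measure X K t x \<in> space (subprob_algebra (count_space X))"
    using p by (auto simp: space_subprob_algebra prob_space_imp_subprob_space step_measure_def
       sets_restrict_space)
qed

sublocale IT: Ionescu_Tulcea "step_measure X K" "\<lambda>_. count_space X"
proof (rule Ionescu_Tulcea.intro)
  show "step_measure X K i \<in> measurable (PiM {0..<i} (\<lambda>_. count_space X)) (subprob_algebra (count_space X))" for i
    by (simp add: PiM_finite_eq step_measure_in_subprob)
  show "prob_space (step_measure X K i x)" if "x \<in> space (PiM {0..<i} (\<lambda>_. count_space X))" for i x
    using that by (intro step_measure_in_subprob) (simp add: PiM_finite_eq)
qed

text \<open>
  The first \<open>n\<close> steps of the Ionescu-Tulcea construction, read as a list, have law \<open>path_pmf K n\<close>;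
  from here on prefixes can be treated by induction on discrete distributions.
\<close>

lemma nn_integral_C:
  "(\<integral>\<^sup>+x. f (map x [0..<n]) \<partial>IT.C 0 n (\<lambda>_. undefined)) = (\<integral>\<^sup>+l. f l \<partial>path_pmf K n)"
proof (induction n arbitrary: f)
  case 0
  show ?case
    by (simp add: nn_integral_return PiM_finite_eq)
next
  case (Suc n)
  let ?u = "\<lambda>_::nat. undefined :: 'x"
  let ?C = "IT.C 0 n ?u"
  let ?F = "\<lambda>l. \<integral>\<^sup>+y. f (l @ [y]) \<partial>K l"
  have u: "?u \<in> space (PiM {0..<0} (\<lambda>_. count_space X))" by (simp add: PiM_finite_eq)
  have "(\<integral>\<^sup>+x. f (map x [0..<Suc n]) \<partial>IT.C 0 (Suc n) ?u) =
     (\<integral>\<^sup>+x. (\<integral>\<^sup>+z. f (map z [0..<Suc n]) \<partial>IT.eP n x) \<partial>?C)"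
    using IT.measurable_eP[of n]
    by (simp, subst nn_integral_bind[where B="PiM {0..<Suc n} (\<lambda>_. count_space X)"])
       (auto simp: PiM_finite_eq measurable_cong_sets[OF IT.sets_C[OF u]])
  also have "\<dots> = (\<integral>\<^sup>+x. ?F (map x [0..<n]) \<partial>?C)"
  proof (rule nn_integral_cong)
    fix x assume "x \<in> space ?C"
    then have x: "x \<in> space (PiM {0..<n} (\<lambda>_. count_space X))" using IT.space_C[OF u, of n] by simp
    then have "map x [0..<n] \<in> lists X"
      by (auto simp: PiM_finite_eq PiE_iff)
    then have sub: "set_pmf (K (map x [0..<n])) \<subseteq> X" by (rule closed)
    have "(\<integral>\<^sup>+z. f (map z [0..<Suc n]) \<partial>IT.eP n x) =
        (\<integral>\<^sup>+y. f (map (x(n := y)) [0..<Suc n]) \<partial>step_measure X K n x)"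
      by (rule IT.nn_integral_eP[OF x]) (simp add: PiM_finite_eq)
    also have "\<dots> = (\<integral>\<^sup>+y. f (map x [0..<n] @ [y]) \<partial>step_measure X K n x)"
      by (simp only: map_prefix_upd)
    also have "\<dots> = (\<integral>\<^sup>+y. f (map x [0..<n] @ [y]) * indicator X y \<partial>K (map x [0..<n]))"
      by (simp add: step_measure_def nn_integral_restrict_space)
    also have "\<dots> = ?F (map x [0..<n])"
      using sub by (intro nn_integral_cong_AE) (auto simp: AE_measure_pmf_iff)
    finally show "(\<integral>\<^sup>+z. f (map z [0..<Suc n]) \<partial>IT.eP n x) = ?F (map x [0..<n])" .
  qed
  also have "\<dots> = (\<integral>\<^sup>+l. f l \<partial>path_pmf K (Suc n))"
    using Suc.IH[of ?F] by simp
  finally show ?case .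
qed

lemma sets_process_law [measurable_cong]: "sets (process_law X K) = sets (PiM UNIV (\<lambda>_. count_space X))"
  by (simp add: process_law_def)

lemma space_process_law: "space (process_law X K) = (UNIV \<rightarrow>\<^sub>E X)"
  by (simp add: process_law_def space_PiM)

lemma measurable_prefix [measurable]:
  "(\<lambda>x. f (map x [0..<n])) \<in> measurable (PiM UNIV (\<lambda>_. count_space X)) (count_space UNIV)"
proof -
  have "(\<lambda>x. f (map (restrict x {0..<n}) [0..<n])) \<in> measurable (PiM UNIV (\<lambda>_. count_space X)) (count_space UNIV)"
    by (rule measurable_compose[OF measurable_restrict_subset[of "{0..<n}"]])
      (simp_all add: PiM_finite_eq)
  then show ?thesis by (simp only: map_prefix_restrict)
qed

lemma borel_measurable_prefix [measurable]:
  "(\<lambda>x. f (map x [0..<n])) \<in> borel_measurable (PiM UNIV (\<lambda>_. count_space X))"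
  by (rule measurable_compose[OF measurable_prefix[of "\<lambda>l. l"]]) simp

lemma distr_prefix: "distr (process_law X K) (count_space UNIV) (\<lambda>x. map x [0..<n]) = path_pmf K n"
proof (rule measure_eqI)
  fix A :: "'x list set"
  let ?u = "\<lambda>_::nat. undefined :: 'x"
  let ?M = "\<lambda>_. count_space X"
  have up: "IT.up_to {0..<n} = n"
    unfolding IT.up_to_def by (rule Least_equality) (auto intro: leI)
  have res: "(\<lambda>f. restrict f {0..<n}) \<in> measurable (IT.C 0 n ?u) (PiM {0..<n} ?M)"
  proof (subst measurable_cong_sets[OF _ refl])
    show "sets (IT.C 0 n ?u) = sets (PiM {0..<n} ?M)"
      using IT.sets_C[of ?u 0 n] by (simp add: PiM_finite_eq)
  qed (intro measurable_restrict_subset order_refl)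
  have resU: "(\<lambda>f. restrict f {0..<n}) \<in> measurable (process_law X K) (PiM {0..<n} ?M)"
    by (subst measurable_cong_sets[OF sets_process_law refl]) (intro measurable_restrict_subset subset_UNIV)
  have "emeasure (distr (process_law X K) (count_space UNIV) (\<lambda>x. map x [0..<n])) A
     = (\<integral>\<^sup>+x. indicator A (map (restrict x {0..<n}) [0..<n]) \<partial>process_law X K)"
    unfolding map_prefix_restrict
    by (subst nn_integral_indicator[symmetric], simp, subst nn_integral_distr) simp_all
  also have "\<dots> = (\<integral>\<^sup>+x. indicator A (map x [0..<n]) \<partial>distr (process_law X K) (PiM {0..<n} ?M) (\<lambda>x. restrict x {0..<n}))"
    by (subst nn_integral_distr[OF resU]) (simp_all add: PiM_finite_eq)
  also have "distr (process_law X K) (PiM {0..<n} ?M) (\<lambda>x. restrict x {0..<n}) = IT.CI {0..<n}"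
    unfolding process_law_def by (rule IT.distr_lim) simp
  also have "(\<integral>\<^sup>+x. indicator A (map x [0..<n]) \<partial>IT.CI {0..<n}) = (\<integral>\<^sup>+x. indicator A (map x [0..<n]) \<partial>IT.C 0 n ?u)"
    unfolding IT.CI_def up using res
    by (subst nn_integral_distr) (auto simp: PiM_finite_eq map_prefix_restrict simp del: map_eq_conv restrict_apply)
  also have "\<dots> = emeasure (path_pmf K n) A"
    by (simp add: nn_integral_C)
  finally show "emeasure (distr (process_law X K) (count_space UNIV) (\<lambda>x. map x [0..<n])) A
     = emeasure (path_pmf K n) A" .
qed simp

lemma prob_space_process_law: "prob_space (process_law X K)"
proof (rule prob_spaceI)
  have "emeasure (process_law X K) (space (process_law X K)) =
     emeasure (distr (process_law X K) (count_space UNIV) (\<lambda>x. map x [0..<0])) UNIV"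
    by (subst emeasure_distr) auto
  then show "emeasure (process_law X K) (space (process_law X K)) = 1"
    unfolding distr_prefix by simp
qed

lemma AE_prefix:
  assumes "\<And>l. l \<in> set_pmf (path_pmf K n) \<Longrightarrow> P l"
  shows "AE x in process_law X K. P (map x [0..<n])"
proof (rule AE_distrD[where P=P])
  show "(\<lambda>x. map x [0..<n]) \<in> measurable (process_law X K) (count_space UNIV)" by measurable
  show "AE x in distr (process_law X K) (count_space UNIV) (\<lambda>x. map x [0..<n]). P x"
    unfolding distr_prefix using assms by (simp add: AE_measure_pmf_iff)
qed

text \<open>
  Finite-dimensional boxes form an intersection-stable generator of the product sigma-algebra, hence
  the laws of all prefixes determine the law of the process.
\<close>

lemma process_law_eqI:
  assumes sets: "sets M = sets (PiM UNIV (\<lambda>_. count_space X))"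
    and "\<And>n. distr M (count_space UNIV) (\<lambda>x. map x [0..<n]) = path_pmf K n"
  shows "M = process_law X K"
proof -
  interpret P: prob_space "process_law X K" by (rule prob_space_process_law)
  have "process_law X K = M"
  proof (rule measure_eqI_PiM_infinite)
    fix A :: "nat \<Rightarrow> 'x set" and J :: "nat set"
    assume J: "finite J" "J \<subseteq> UNIV" and A: "\<And>i. i \<in> J \<Longrightarrow> A i \<in> sets (count_space X)"
    \<comment> \<open>A box constrains finitely many coordinates, so it is an event about a prefix.\<close>
    obtain n where n: "J \<subseteq> {..<n}" using J(1) finite_nat_iff_bounded by blast
    let ?L = "{l. \<forall>j\<in>J. l ! j \<in> A j}"
    let ?E = "prod_emb UNIV (\<lambda>_. count_space X) J (Pi\<^sub>E J A)"
    have E: "?E = (\<lambda>x. map x [0..<n]) -` ?L \<inter> (UNIV \<rightarrow>\<^sub>E X)"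
      using n by (auto simp: prod_emb_def space_PiM PiE_iff subset_iff Ball_def) 
    have sp: "space M = (UNIV \<rightarrow>\<^sub>E X)" using sets_eq_imp_space_eq[OF sets] by (simp add: space_PiM)
    have "emeasure (process_law X K) ?E = emeasure (path_pmf K n) ?L"
      unfolding distr_prefix[symmetric] E by (subst emeasure_distr) (auto simp: space_process_law)
    also have "\<dots> = emeasure M ?E"
      unfolding assms(2)[symmetric] E
      by (subst emeasure_distr) (auto simp: sp measurable_cong_sets[OF sets refl])
    finally show "emeasure (process_law X K) ?E = emeasure M ?E" .
  qed (use assms in \<open>auto simp: sets_process_law P.emeasure_eq_measure intro: P.finite_measure_axioms\<close>)
  then show ?thesis ..
qed

end

section \<open>A strong law for bounded martingale differences\<close>

text \<open>
  Between consecutive squares \<open>k\<^sup>2\<close> and \<open>(k + 1)\<^sup>2\<close> a sum of terms bounded by \<open>C\<close> moves by at most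
  \<open>2 k C\<close>, which is negligible against \<open>k\<^sup>2\<close>.
\<close>

lemma averages_tendsto_0_if_square_subsequence:
  fixes a :: "nat \<Rightarrow> real"
  assumes bound: "\<And>t. \<bar>a t\<bar> \<le> C"
    and sub: "(\<lambda>k. (\<Sum>t<k\<^sup>2. a t) / real (k\<^sup>2)) \<longlonglongrightarrow> 0"
  shows "(\<lambda>T. (\<Sum>t<T. a t) / real T) \<longlonglongrightarrow> 0"
proof -
  define r where "r T = nat \<lfloor>sqrt (real T)\<rfloor>" for T
  \<comment> \<open>The average at time T is compared with the one at the largest square below T.\<close>
  define b where "b k = \<bar>(\<Sum>t<k\<^sup>2. a t) / real (k\<^sup>2)\<bar> + 2 * C / real k" for k
  have "b \<longlonglongrightarrow> 0 + 0"
    unfolding b_def by (intro tendsto_add tendsto_rabs_zero sub lim_const_over_n)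
  moreover have "filterlim r sequentially sequentially"
    unfolding r_def
    by (intro filterlim_compose[OF filterlim_nat_sequentially] filterlim_compose[OF filterlim_floor_sequentially]
          filterlim_compose[OF sqrt_at_top] filterlim_real_sequentially)
  ultimately have "(\<lambda>T. b (r T)) \<longlonglongrightarrow> 0"
    using filterlim_compose by fastforce
  moreover have "norm ((\<Sum>t<T. a t) / real T) \<le> b (r T)" if "T \<ge> 1" for T
  proof -
    let ?k = "r T"
    have C: "0 \<le> C" using bound[of 0] by simp
    have rk: "real ?k \<le> sqrt (real T)" "sqrt (real T) < real ?k + 1"
      unfolding r_def by (simp_all add: of_nat_nat)
    have k1: "?k \<ge> 1"
      using that unfolding r_def by (simp add: le_nat_iff)
    have lo: "real (?k\<^sup>2) \<le> real T"
      using power_mono[OF rk(1), of 2] by simp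
    have "(sqrt (real T))\<^sup>2 < (real ?k + 1)\<^sup>2"
      using rk(2) by (intro power_strict_mono) auto
    then have "real T < real ((?k + 1)\<^sup>2)" by (simp add: add.commute)
    then have "T < (?k + 1)\<^sup>2" by (simp only: of_nat_less_iff)
    then have hi: "T - ?k\<^sup>2 \<le> 2 * ?k" by (simp add: power2_eq_square algebra_simps)
    have lo': "?k\<^sup>2 \<le> T" using lo by (simp only: of_nat_le_iff)
    have "(\<Sum>t<T. a t) = (\<Sum>t<?k\<^sup>2. a t) + (\<Sum>t\<in>{?k\<^sup>2..<T}. a t)"
      using sum.atLeastLessThan_concat[of 0 "?k\<^sup>2" T a] lo' by (simp add: atLeast0LessThan)
    moreover have "\<bar>\<Sum>t\<in>{?k\<^sup>2..<T}. a t\<bar> \<le> real (2 * ?k) * C"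
    proof -
      have "\<bar>\<Sum>t\<in>{?k\<^sup>2..<T}. a t\<bar> \<le> (\<Sum>t\<in>{?k\<^sup>2..<T}. C)"
        by (rule order_trans[OF sum_abs]) (intro sum_mono bound)
      also have "\<dots> = real (T - ?k\<^sup>2) * C" by simp
      also have "\<dots> \<le> real (2 * ?k) * C"
        using hi C by (intro mult_right_mono) (simp_all only: of_nat_le_iff)
      finally show ?thesis .
    qed
    ultimately have "\<bar>\<Sum>t<T. a t\<bar> \<le> \<bar>\<Sum>t<?k\<^sup>2. a t\<bar> + real (2 * ?k) * C" by linarith
    then have "\<bar>\<Sum>t<T. a t\<bar> / real T \<le> (\<bar>\<Sum>t<?k\<^sup>2. a t\<bar> + real (2 * ?k) * C) / real (?k\<^sup>2)"
      using lo k1 C by (intro frac_le) auto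
    also have "\<dots> = b ?k"
      using k1 unfolding b_def by (simp add: add_divide_distrib power2_eq_square)
    finally show ?thesis by simp
  qed
  then have "\<forall>\<^sub>F T in sequentially. norm ((\<Sum>t<T. a t) / real T) \<le> b (r T)"
    using eventually_sequentially by blast
  ultimately show ?thesis by (rule Lim_null_comparison[rotated])
qed

context history_process
begin

lemma finite_set_K: "l \<in> lists X \<Longrightarrow> finite (set_pmf (K l))"
  using closed finite_X finite_subset by blast

lemma finite_set_path_pmf: "finite (set_pmf (path_pmf K n))"
proof (rule finite_subset)
  show "set_pmf (path_pmf K n) \<subseteq> {l. set l \<subseteq> X \<and> length l = n}"
    using set_path_pmf by blast
qed (use finite_X in \<open>simp add: finite_lists_length_eq\<close>)

lemma expectation_path_pmf_Suc:
  fixes f :: "'x list \<Rightarrow> real"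
  shows "measure_pmf.expectation (path_pmf K (Suc n)) f =
    measure_pmf.expectation (path_pmf K n) (\<lambda>l. measure_pmf.expectation (K l) (\<lambda>y. f (l @ [y])))"
proof -
  have "measure_pmf.expectation (path_pmf K (Suc n)) f =
     (\<Sum>l\<in>set_pmf (path_pmf K n). pmf (path_pmf K n) l *\<^sub>R measure_pmf.expectation (map_pmf (\<lambda>x. l @ [x]) (K l)) f)"
    unfolding path_pmf.simps
    by (rule pmf_expectation_bind[OF finite_set_path_pmf]) (auto dest!: set_path_pmf intro!: finite_imageI finite_set_K)
  also have "\<dots> = (\<Sum>l\<in>set_pmf (path_pmf K n). pmf (path_pmf K n) l *\<^sub>R measure_pmf.expectation (K l) (\<lambda>y. f (l @ [y])))"
    by simp
  also have "\<dots> = measure_pmf.expectation (path_pmf K n) (\<lambda>l. measure_pmf.expectation (K l) (\<lambda>y. f (l @ [y])))"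
    by (rule integral_measure_pmf[symmetric]) (auto simp: finite_set_path_pmf)
  finally show ?thesis .
qed

definition accumulate :: "('x list \<Rightarrow> 'x \<Rightarrow> real) \<Rightarrow> 'x list \<Rightarrow> real" where
  "accumulate F l = (\<Sum>t<length l. F (take t l) (l ! t))"

lemma accumulate_snoc: "accumulate F (l @ [y]) = accumulate F l + F l y"
  by (simp add: accumulate_def nth_append)

lemma accumulate_prefix: "accumulate F (map x [0..<n]) = (\<Sum>t<n. F (map x [0..<t]) (x t))"
  by (simp add: accumulate_def take_map)

text \<open>
  Increments with conditional mean zero are orthogonal to the past, so second moments add up: the
  cross term \<open>2 S F\<close> integrates to zero against the last step.
\<close>

lemma second_moment_bound:
  assumes bound: "\<And>l y. l \<in> lists X \<Longrightarrow> y \<in> X \<Longrightarrow> \<bar>F l y\<bar> \<le> C"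
    and mean: "\<And>l. l \<in> lists X \<Longrightarrow> measure_pmf.expectation (K l) (F l) = 0"
  shows "measure_pmf.expectation (path_pmf K n) (\<lambda>l. (accumulate F l)\<^sup>2) \<le> real n * C\<^sup>2"
proof (induction n)
  case 0
  show ?case by (simp add: accumulate_def)
next
  case (Suc n)
  have "measure_pmf.expectation (path_pmf K (Suc n)) (\<lambda>l. (accumulate F l)\<^sup>2) =
     measure_pmf.expectation (path_pmf K n) (\<lambda>l. measure_pmf.expectation (K l) (\<lambda>y. (accumulate F l + F l y)\<^sup>2))"
    by (simp only: expectation_path_pmf_Suc accumulate_snoc)
  also have "\<dots> \<le> measure_pmf.expectation (path_pmf K n) (\<lambda>l. (accumulate F l)\<^sup>2 + C\<^sup>2)"
  proof (intro integral_mono_AE integrable_measure_pmf_finite finite_set_path_pmf, unfold AE_measure_pmf_iff, intro ballI)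
    fix l assume "l \<in> set_pmf (path_pmf K n)"
    then have l: "l \<in> lists X" by (simp add: set_path_pmf)
    note [simp] = integrable_measure_pmf_finite[OF finite_set_K[OF l]]
    have "measure_pmf.expectation (K l) (\<lambda>y. (accumulate F l + F l y)\<^sup>2) =
        measure_pmf.expectation (K l) (\<lambda>y. (accumulate F l)\<^sup>2 + (2 * accumulate F l * F l y + (F l y)\<^sup>2))"
      by (simp add: power2_sum algebra_simps)
    also have "\<dots> = (accumulate F l)\<^sup>2 + measure_pmf.expectation (K l) (\<lambda>y. (F l y)\<^sup>2)"
      by (simp add: mean[OF l])
    also have "measure_pmf.expectation (K l) (\<lambda>y. (F l y)\<^sup>2) \<le> measure_pmf.expectation (K l) (\<lambda>y. C\<^sup>2)"
    proof (intro integral_mono_AE, simp, simp, unfold AE_measure_pmf_iff, intro ballI)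
      fix y assume "y \<in> set_pmf (K l)"
      then have "\<bar>F l y\<bar> \<le> C" using closed[OF l] by (intro bound[OF l]) auto
      then show "(F l y)\<^sup>2 \<le> C\<^sup>2" by (rule abs_le_square_iff[THEN iffD1, OF order_trans]) simp
    qed
    finally show "measure_pmf.expectation (K l) (\<lambda>y. (accumulate F l + F l y)\<^sup>2) \<le> (accumulate F l)\<^sup>2 + C\<^sup>2"
      by simp
  qed
  also have "\<dots> = measure_pmf.expectation (path_pmf K n) (\<lambda>l. (accumulate F l)\<^sup>2) + C\<^sup>2"
    by (simp add: integrable_measure_pmf_finite[OF finite_set_path_pmf])
  finally show ?case using Suc.IH by (simp add: algebra_simps)
qed

lemma in_X_process_law: "x \<in> space (process_law X K) \<Longrightarrow> x t \<in> X"
  by (auto simp: space_process_law PiE_iff)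

text \<open>
  Along the squares, the second moment of the \<open>k\<close>-th average is at most \<open>C\<^sup>2 / k\<^sup>2\<close>, which is summable, so the
  squared averages are almost surely summable and tend to zero.  Boundedness of the increments fills
  the gaps between the squares.
\<close>

lemma martingale_difference_slln:
  assumes bound: "\<And>l y. l \<in> lists X \<Longrightarrow> y \<in> X \<Longrightarrow> \<bar>F l y\<bar> \<le> C"
    and mean: "\<And>l. l \<in> lists X \<Longrightarrow> measure_pmf.expectation (K l) (F l) = 0"
  shows "AE x in process_law X K. (\<lambda>T. (\<Sum>t<T. F (map x [0..<t]) (x t)) / real T) \<longlonglongrightarrow> 0"
proof -
  define S where "S k l = (accumulate F l / real (k\<^sup>2))\<^sup>2" for k l
  let ?Y = "\<lambda>k x. S k (map x [0..<k\<^sup>2])"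
  have int: "(\<integral>\<^sup>+x. ennreal (?Y k x) \<partial>process_law X K) \<le> ennreal (C\<^sup>2 * inverse (real k ^ 2))" for k
  proof -
    have "(\<integral>\<^sup>+x. ennreal (?Y k x) \<partial>process_law X K) = (\<integral>\<^sup>+l. ennreal (S k l) \<partial>path_pmf K (k\<^sup>2))"
      by (subst distr_prefix[symmetric], subst nn_integral_distr) auto
    also have "\<dots> = ennreal (measure_pmf.expectation (path_pmf K (k\<^sup>2)) (S k))"
      by (intro nn_integral_eq_integral integrable_measure_pmf_finite finite_set_path_pmf) (auto simp: S_def)
    also have "\<dots> \<le> ennreal (C\<^sup>2 * inverse (real k ^ 2))"
    proof (rule ennreal_leI)
      have "measure_pmf.expectation (path_pmf K (k\<^sup>2)) (S k) =
         measure_pmf.expectation (path_pmf K (k\<^sup>2)) (\<lambda>l. (accumulate F l)\<^sup>2) / (real (k\<^sup>2))\<^sup>2"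
        unfolding S_def power_divide by (rule integral_divide_zero)
      also have "\<dots> \<le> real (k\<^sup>2) * C\<^sup>2 / (real (k\<^sup>2))\<^sup>2"
        by (intro divide_right_mono second_moment_bound bound mean) auto
      also have "\<dots> = C\<^sup>2 * inverse (real k ^ 2)"
        by (simp add: power2_eq_square field_simps)
      finally show "measure_pmf.expectation (path_pmf K (k\<^sup>2)) (S k) \<le> C\<^sup>2 * inverse (real k ^ 2)" .
    qed
    finally show ?thesis .
  qed
  have "(\<integral>\<^sup>+x. (\<Sum>k. ennreal (?Y k x)) \<partial>process_law X K) = (\<Sum>k. \<integral>\<^sup>+x. ennreal (?Y k x) \<partial>process_law X K)"
    by (rule nn_integral_suminf) measurable
  also have "\<dots> \<le> (\<Sum>k. ennreal (C\<^sup>2 * inverse (real k ^ 2)))"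
    by (intro suminf_le int summableI)
  also have "\<dots> < \<infinity>"
    using summable_mult[OF inverse_power_summable[of 2, where 'a=real], of "C\<^sup>2"]
    by (subst suminf_ennreal2) auto
  finally have "AE x in process_law X K. (\<Sum>k. ennreal (?Y k x)) \<noteq> \<infinity>"
    by (intro nn_integral_PInf_AE) auto
  moreover have "AE x in process_law X K. x \<in> space (process_law X K)" by (rule AE_space)
  ultimately show ?thesis
  proof eventually_elim
    fix x assume fin: "(\<Sum>k. ennreal (?Y k x)) \<noteq> \<infinity>" and x: "x \<in> space (process_law X K)"
    let ?a = "\<lambda>t. F (map x [0..<t]) (x t)"
    have "summable (\<lambda>k. ?Y k x)"
      using fin by (intro summable_suminf_not_top) (auto simp: S_def)
    then have "(\<lambda>k. ?Y k x) \<longlonglongrightarrow> 0" by (rule summable_LIMSEQ_zero)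
    then have "(\<lambda>k. sqrt (?Y k x)) \<longlonglongrightarrow> sqrt 0" by (rule tendsto_real_sqrt)
    then have "(\<lambda>k. (\<Sum>t<k\<^sup>2. ?a t) / real (k\<^sup>2)) \<longlonglongrightarrow> 0"
      by - (rule tendsto_rabs_zero_cancel, simp add: S_def accumulate_prefix)
    moreover have "\<bar>?a t\<bar> \<le> C" for t
      using x by (intro bound) (auto simp: in_X_process_law)
    ultimately show "(\<lambda>T. (\<Sum>t<T. ?a t) / real T) \<longlonglongrightarrow> 0"
      by (intro averages_tendsto_0_if_square_subsequence)
  qed
qed

end

section \<open>Poisson equations and optimal stationary rules\<close>

text \<open>
  Injectivity implies surjectivity for square systems whose rows and columns are indexed by finite
  subsets of arbitrary types.  The induction is Gaussian elimination: pivot on some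
  \<open>A p c \<noteq> 0\<close> and pass to the Schur complement.
\<close>

lemma square_system_solvable:
  fixes A :: "'r \<Rightarrow> 'c \<Rightarrow> 'k::field"
  assumes "finite R" "finite V" "card R = card V"
    and "\<And>x. (\<And>r. r \<in> R \<Longrightarrow> (\<Sum>v\<in>V. A r v * x v) = 0) \<Longrightarrow> \<forall>v\<in>V. x v = 0"
  shows "\<exists>x. \<forall>r\<in>R. (\<Sum>v\<in>V. A r v * x v) = b r"
  using assms(2,1,3,4)
proof (induction V arbitrary: R A b rule: finite_induct)
  case empty
  then show ?case by simp
next
  case (insert c V)
  \<comment> \<open>Otherwise the unit vector of column c would be a nonzero kernel element.\<close>
  have "\<exists>r\<in>R. A r c \<noteq> 0"
  proof (rule ccontr)
    assume "\<not> (\<exists>r\<in>R. A r c \<noteq> 0)"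
    then have "(\<Sum>v\<in>insert c V. A r v * (if v = c then 1 else 0)) = 0" if "r \<in> R" for r
      using that insert.hyps by (auto intro!: sum.neutral)
    from insert.prems(3)[OF this] show False by simp
  qed
  then obtain p where p: "p \<in> R" "A p c \<noteq> 0" by blast
  let ?R = "R - {p}"
  let ?B = "\<lambda>r v. A r v - A r c * A p v / A p c"
  \<comment> \<open>Extends a vector on V by the entry at c that makes row p evaluate to y.\<close>
  define lift where "lift y x = x(c := (y - (\<Sum>v\<in>V. A p v * x v)) / A p c)" for y x
  have lift_V: "(\<Sum>v\<in>V. f v * lift y x v) = (\<Sum>v\<in>V. f v * x v)" for f y x
    using insert.hyps(2) by (intro sum.cong) (auto simp: lift_def)
  have lift_p: "(\<Sum>v\<in>insert c V. A p v * lift y x v) = y" for y x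
    using insert.hyps p by (simp add: lift_V) (simp add: lift_def)
  have lift_r: "(\<Sum>v\<in>insert c V. A r v * lift y x v) = (\<Sum>v\<in>V. ?B r v * x v) + A r c * y / A p c" for r y x
  proof -
    have "(\<Sum>v\<in>V. ?B r v * x v) = (\<Sum>v\<in>V. A r v * x v) - A r c / A p c * (\<Sum>v\<in>V. A p v * x v)"
      by (simp add: algebra_simps sum_subtractf sum_distrib_left)
    then show ?thesis
      using insert.hyps p by (simp add: lift_V) (simp add: lift_def field_simps)
  qed
  have card: "card ?R = card V"
    using insert.prems(1,2) insert.hyps p by simp
  have ker: "\<forall>v\<in>V. x v = 0" if x: "\<And>r. r \<in> ?R \<Longrightarrow> (\<Sum>v\<in>V. ?B r v * x v) = 0" for x
  proof -
    have "(\<Sum>v\<in>insert c V. A r v * lift 0 x v) = 0" if "r \<in> R" for r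
    proof (cases "r = p")
      case True
      then show ?thesis by (simp only: lift_p)
    next
      case False
      then show ?thesis using x[of r] that by (simp only: lift_r) simp
    qed
    from insert.prems(3)[OF this] have "\<forall>v\<in>V. lift 0 x v = 0" by simp
    moreover have "lift 0 x v = x v" if "v \<in> V" for v
      using that insert.hyps(2) by (auto simp: lift_def)
    ultimately show ?thesis by simp
  qed
  obtain x where x: "\<forall>r\<in>?R. (\<Sum>v\<in>V. ?B r v * x v) = b r - A r c * b p / A p c"
    using insert.IH[of ?R ?B "\<lambda>r. b r - A r c * b p / A p c", OF _ card ker] insert.prems(1) by auto
  have "(\<Sum>v\<in>insert c V. A r v * lift (b p) x v) = b r" if "r \<in> R" for r
  proof (cases "r = p")
    case True
    then show ?thesis by (simp only: lift_p)
  next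
    case False
    then show ?thesis using x that by (simp only: lift_r) simp
  qed
  then show ?case by blast
qed

lemma expectation_eq_bound_imp_eq:
  fixes w :: "'s \<Rightarrow> real"
  assumes fin: "finite (set_pmf p)" and le: "\<And>y. y \<in> set_pmf p \<Longrightarrow> w y \<le> M"
    and ge: "M \<le> measure_pmf.expectation p w" and y: "y \<in> set_pmf p"
  shows "w y = M"
proof -
  note [simp] = integrable_measure_pmf_finite[OF fin]
  have nonneg: "AE y in p. 0 \<le> M - w y" using le by (simp add: AE_measure_pmf_iff)
  have "measure_pmf.expectation p (\<lambda>y. M - w y) = 0"
    using ge integral_nonneg_AE[OF nonneg] by simp
  then have "AE y in p. M - w y = 0"
    using integral_nonneg_eq_0_iff_AE[OF _ nonneg] by simp
  then show ?thesis using y by (simp add: AE_measure_pmf_iff)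
qed

locale irreducible_finite_chain =
  fixes S :: "'s set" and k :: "'s \<Rightarrow> 's pmf"
  assumes finite_S: "finite S" and nonempty: "S \<noteq> {}"
    and closed: "\<And>s. s \<in> S \<Longrightarrow> set_pmf (k s) \<subseteq> S"
    and irreducible: "irreducible_chain S k"
begin

lemma finite_set_k: "s \<in> S \<Longrightarrow> finite (set_pmf (k s))"
  using closed finite_S finite_subset by blast

lemma integrable_k: "s \<in> S \<Longrightarrow> integrable (k s) (f :: 's \<Rightarrow> real)"
  by (simp add: finite_set_k integrable_measure_pmf_finite)

text \<open>
  Maximum principle: at a maximum point the average over the successors is at most the maximum, so
  all successors are maximum points, and by irreducibility so are all states.
\<close>

lemma subharmonic_imp_constant:
  fixes w :: "'s \<Rightarrow> real"
  assumes sub: "\<And>s. s \<in> S \<Longrightarrow> w s \<le> measure_pmf.expectation (k s) w"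
    and "s \<in> S" "t \<in> S"
  shows "w s = w t"
proof -
  define M where "M = Max (w ` S)"
  have le: "w s \<le> M" if "s \<in> S" for s
    using that finite_S by (simp add: M_def)
  have "M \<in> w ` S"
    unfolding M_def using finite_S nonempty by (intro Max_in) auto
  then obtain z where z: "z \<in> S" "w z = M" by blast
  have reach: "y \<in> S \<and> w y = M" if "y \<in> set_pmf (nstep k m z)" for m y
    using that
  proof (induction m arbitrary: y)
    case 0
    then show ?case using z by simp
  next
    case (Suc m)
    then obtain x where x: "x \<in> set_pmf (nstep k m z)" "y \<in> set_pmf (k x)" by auto
    from Suc.IH[OF x(1)] have "x \<in> S" "w x = M" by auto
    have "w y = M"
    proof (rule expectation_eq_bound_imp_eq[of "k x"])
      show "w t \<le> M" if "t \<in> set_pmf (k x)" for t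
        using that closed[OF \<open>x \<in> S\<close>] by (intro le) blast
      show "M \<le> measure_pmf.expectation (k x) w"
        using sub[OF \<open>x \<in> S\<close>] \<open>w x = M\<close> by simp
    qed (use x finite_set_k[OF \<open>x \<in> S\<close>] in simp_all)
    then show ?case using x closed[OF \<open>x \<in> S\<close>] by blast
  qed
  have "w y = M" if y: "y \<in> S" for y
  proof -
    obtain m where "pmf (nstep k m z) y > 0"
      using irreducible z y unfolding irreducible_chain_def by blast
    then show ?thesis using reach[of y m] by (simp add: set_pmf_iff less_imp_neq[symmetric])
  qed
  then show ?thesis using assms(2,3) by simp
qed

text \<open>
  Counting unknowns, \<open>h\<close> normalised to vanish at one state together with the constant \<open>g\<close> gives a
  square linear system.  Its kernel is trivial by the maximum principle, applied to \<open>h\<close> or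
  \<open>- h\<close> according to the sign of \<open>g\<close>.
\<close>

lemma poisson_equation:
  fixes f :: "'s \<Rightarrow> real"
  shows "\<exists>g h. \<forall>s\<in>S. g + h s = f s + measure_pmf.expectation (k s) h"
proof -
  obtain z where z: "z \<in> S" using nonempty by blast
  \<comment> \<open>The unknown at the reference state z encodes the gain g; column z is therefore constantly 1.\<close>
  let ?A = "\<lambda>s t. if t = z then 1 else (if s = t then 1 else 0) - pmf (k s) t"
  have A: "(\<Sum>t\<in>S. ?A s t * x t) = x z + (x(z := 0)) s - measure_pmf.expectation (k s) (x(z := 0))"
    if s: "s \<in> S" for s x
  proof -
    let ?h = "x(z := 0)"
    have "(\<Sum>t\<in>S. ?A s t * x t) = (\<Sum>t\<in>S. (if t = z then x t else 0) + (if s = t then ?h t else 0) - ?h t * pmf (k s) t)"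
      by (intro sum.cong) (auto simp: algebra_simps)
    also have "\<dots> = x z + ?h s - (\<Sum>t\<in>S. ?h t * pmf (k s) t)"
      using finite_S s z by (simp add: sum.distrib sum_subtractf)
    also have "(\<Sum>t\<in>S. ?h t * pmf (k s) t) = measure_pmf.expectation (k s) ?h"
      using closed[OF s] finite_S by (intro integral_measure_pmf_real[symmetric]) auto
    finally show ?thesis .
  qed
  have ker: "\<forall>t\<in>S. x t = 0" if x: "\<And>s. s \<in> S \<Longrightarrow> (\<Sum>t\<in>S. ?A s t * x t) = 0" for x
  proof -
    let ?h = "x(z := 0)"
    have eq: "measure_pmf.expectation (k s) ?h = x z + ?h s" if "s \<in> S" for s
      using x[OF that] A[OF that] by simp
    have "?h s = ?h z" if "s \<in> S" for s
    proof (cases "x z \<ge> 0")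
      case True
      then show ?thesis
        using that z eq by (intro subharmonic_imp_constant[of ?h s z]) (simp_all del: fun_upd_apply)
    next
      case False
      then have "- ?h s = - ?h z"
        using that z eq
        by (intro subharmonic_imp_constant[of "\<lambda>s. - ?h s" s z]) (simp_all del: fun_upd_apply)
      then show ?thesis by simp
    qed
    then have h: "?h s = 0" if "s \<in> S" for s using that by simp
    have "measure_pmf.expectation (k z) ?h = measure_pmf.expectation (k z) (\<lambda>_. 0)"
      using closed[OF z] h by (intro integral_cong_AE) (auto simp: AE_measure_pmf_iff subset_iff)
    then have x0: "x z = 0" using eq[OF z] by simp
    have "x t = 0" if "t \<in> S" for t
      using h[OF that] x0 by (cases "t = z") simp_all
    then show ?thesis ..
  qed
  have "\<exists>x. \<forall>s\<in>S. (\<Sum>t\<in>S. ?A s t * x t) = f s"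
    by (rule square_system_solvable[OF finite_S finite_S refl]) (rule ker)
  then obtain x where "\<forall>s\<in>S. (\<Sum>t\<in>S. ?A s t * x t) = f s" ..
  then have "x z + (x(z := 0)) s = f s + measure_pmf.expectation (k s) (x(z := 0))" if "s \<in> S" for s
    using A[OF that, of x] that by (simp del: fun_upd_apply)
  then show ?thesis by (intro exI[of _ "x z"] exI[of _ "x(z := 0)"] ballI)
qed

end

text \<open>
  Take the rule with the least gain among the finitely many stationary ones.  If some action strictly
  beat its Poisson equation at one state, switching to this action there would yield a rule with relative
  value \<open>h'\<close> such that \<open>h' - h\<close> is subharmonic for the new chain, because the new gain is no smaller.
  By the maximum principle \<open>h' - h\<close> is constant, which contradicts the strictness at that state.
\<close>

lemma average_cost_optimality:
  fixes p :: "'s \<Rightarrow> 'a \<Rightarrow> 's pmf" and c :: "'s \<Rightarrow> 'a \<Rightarrow> real"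
  assumes chain: "\<And>d. d \<in> S \<rightarrow>\<^sub>E A \<Longrightarrow> irreducible_finite_chain S (\<lambda>s. p s (d s))"
    and fin: "finite S" "finite A" and ne: "A \<noteq> {}"
  shows "\<exists>d\<in>S \<rightarrow>\<^sub>E A. \<exists>g h.
    (\<forall>s\<in>S. g + h s = c s (d s) + measure_pmf.expectation (p s (d s)) h) \<and>
    (\<forall>s\<in>S. \<forall>a\<in>A. g + h s \<le> c s a + measure_pmf.expectation (p s a) h)"
proof -
  let ?E = "\<lambda>s a. measure_pmf.expectation (p s a)"
  have "\<forall>d\<in>S \<rightarrow>\<^sub>E A. \<exists>g h. \<forall>s\<in>S. g + h s = c s (d s) + ?E s (d s) h"
    by (intro ballI irreducible_finite_chain.poisson_equation[OF chain])
  from bchoice[OF this] obtain g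
    where "\<forall>d\<in>S \<rightarrow>\<^sub>E A. \<exists>h. \<forall>s\<in>S. g d + h s = c s (d s) + ?E s (d s) h" ..
  from bchoice[OF this] obtain h
    where gh: "\<forall>d\<in>S \<rightarrow>\<^sub>E A. \<forall>s\<in>S. g d + h d s = c s (d s) + ?E s (d s) (h d)" ..
  note gh = gh[rule_format]
  have finD: "finite (S \<rightarrow>\<^sub>E A)" using fin by (intro finite_PiE) auto
  have "Min (g ` (S \<rightarrow>\<^sub>E A)) \<in> g ` (S \<rightarrow>\<^sub>E A)"
    using finD ne by (intro Min_in) (auto simp: PiE_eq_empty_iff)
  then obtain d where d: "d \<in> S \<rightarrow>\<^sub>E A" and "g d = Min (g ` (S \<rightarrow>\<^sub>E A))" by auto
  then have min: "g d \<le> g e" if "e \<in> S \<rightarrow>\<^sub>E A" for e using that finD by simp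
  have "g d + h d s \<le> c s a + ?E s a (h d)" if s: "s \<in> S" and a: "a \<in> A" for s a
  proof (rule ccontr)
    assume less: "\<not> ?thesis"
    define e where "e = d(s := a)"
    have e: "e \<in> S \<rightarrow>\<^sub>E A"
      using d s a unfolding e_def by (auto simp: PiE_iff extensional_def)
    interpret irreducible_finite_chain S "\<lambda>s. p s (e s)" by (rule chain[OF e])
    have le: "c t (e t) + ?E t (e t) (h d) \<le> g d + h d t" if "t \<in> S" for t
      using gh[OF d that] less by (auto simp: e_def)
    let ?w = "\<lambda>t. h e t - h d t"
    have w: "?E t (e t) ?w = g e + h e t - c t (e t) - ?E t (e t) (h d)" if "t \<in> S" for t
      using gh[OF e that] by (simp add: integrable_k[OF that])
    have const: "?w t = ?w s" if "t \<in> S" for t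
    proof (rule subharmonic_imp_constant[of ?w t s])
      show "?w r \<le> ?E r (e r) ?w" if "r \<in> S" for r
        using w[OF that] le[OF that] min[OF e] by linarith
    qed (use that s in simp_all)
    have "?E s (e s) ?w = ?E s (e s) (\<lambda>_. ?w s)"
      using closed[OF s] const by (intro integral_cong_AE) (auto simp: AE_measure_pmf_iff subset_iff)
    then have "?E s (e s) ?w = ?w s" by simp
    moreover have "c s (e s) + ?E s (e s) (h d) < g d + h d s" using less by (simp add: e_def)
    ultimately show False using w[OF s] min[OF e] by simp
  qed
  then have "(\<forall>s\<in>S. g d + h d s = c s (d s) + ?E s (d s) (h d)) \<and>
      (\<forall>s\<in>S. \<forall>a\<in>A. g d + h d s \<le> c s a + ?E s a (h d))"
    using gh[OF d] by simp
  then show ?thesis using d by (iprover intro: bexI exI)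
qed

section \<open>Time averages\<close>

lemma bounded_over_n_tendsto_0:
  fixes e :: "nat \<Rightarrow> real"
  assumes "\<And>n. \<bar>e n\<bar> \<le> B"
  shows "(\<lambda>n. e n / real n) \<longlonglongrightarrow> 0"
proof (rule Lim_null_comparison)
  show "\<forall>\<^sub>F n in sequentially. norm (e n / real n) \<le> B / real n"
    using assms by (intro always_eventually allI) (simp add: divide_right_mono)
qed (rule lim_const_over_n)

lemma abs_expectation_le:
  fixes f :: "'s \<Rightarrow> real"
  assumes "finite (set_pmf p)" and "\<And>y. y \<in> set_pmf p \<Longrightarrow> \<bar>f y\<bar> \<le> B"
  shows "\<bar>measure_pmf.expectation p f\<bar> \<le> B"
proof -
  have int: "integrable (measure_pmf p) f" by (rule integrable_measure_pmf_finite[OF assms(1)])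
  have "measure_pmf.expectation p f \<le> B"
    by (rule measure_pmf.integral_le_const[OF int]) (use assms(2) in \<open>force simp: AE_measure_pmf_iff\<close>)
  moreover have "- B \<le> measure_pmf.expectation p f"
    by (rule measure_pmf.integral_ge_const[OF int]) (use assms(2) in \<open>force simp: AE_measure_pmf_iff\<close>)
  ultimately show ?thesis by simp
qed

lemma abs_le_sum_abs: "finite A \<Longrightarrow> y \<in> A \<Longrightarrow> \<bar>f y\<bar> \<le> (\<Sum>z\<in>A. \<bar>f z :: real\<bar>)"
  by (rule member_le_sum) auto

lemma abs_time_avg_le:
  assumes "\<And>t. \<bar>f t\<bar> \<le> B"
  shows "\<bar>time_avg f T\<bar> \<le> B"
proof (cases "T = 0")
  case True
  then show ?thesis using assms[of 0] by (simp add: time_avg_def)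
next
  case False
  have "\<bar>\<Sum>t<T. f t\<bar> \<le> (\<Sum>t<T. B)"
    by (rule order_trans[OF sum_abs]) (intro sum_mono assms)
  then show ?thesis using False by (simp add: time_avg_def abs_divide divide_le_eq mult.commute)
qed

text \<open>
  The expansion of the square on the level of time averages; it makes the choice of the centre
  \<open>c\<close> explicit in the limit.
\<close>

lemma time_avg_square_shift:
  assumes m: "time_avg r \<longlonglongrightarrow> m" and q: "time_avg (\<lambda>t. (r t)\<^sup>2) \<longlonglongrightarrow> q"
  shows "time_avg (\<lambda>t. (r t - c)\<^sup>2) \<longlonglongrightarrow> q - 2 * c * m + c\<^sup>2"
proof (rule Lim_transform_eventually)
  show "(\<lambda>T. time_avg (\<lambda>t. (r t)\<^sup>2) T - 2 * c * time_avg r T + c\<^sup>2) \<longlonglongrightarrow> q - 2 * c * m + c\<^sup>2"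
    by (intro tendsto_intros m q)
  have "time_avg (\<lambda>t. (r t)\<^sup>2) T - 2 * c * time_avg r T + c\<^sup>2 = time_avg (\<lambda>t. (r t - c)\<^sup>2) T"
    if "T > 0" for T
  proof -
    have "(\<Sum>t<T. (r t - c)\<^sup>2) = (\<Sum>t<T. (r t)\<^sup>2) - 2 * c * (\<Sum>t<T. r t) + real T * c\<^sup>2"
      by (simp add: power2_diff sum.distrib sum_subtractf sum_distrib_left algebra_simps)
    then show ?thesis using that by (simp add: time_avg_def field_simps)
  qed
  then show "\<forall>\<^sub>F T in sequentially. time_avg (\<lambda>t. (r t)\<^sup>2) T - 2 * c * time_avg r T + c\<^sup>2 = time_avg (\<lambda>t. (r t - c)\<^sup>2) T"
    using eventually_gt_at_top[of 0] by (rule eventually_mono[rotated])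
qed

text \<open>
  On paths where the averages converge, their limit inherits the bound of the one-step function.
\<close>

lemma (in history_process) integrable_lim_time_avg:
  fixes f :: "'x \<Rightarrow> real"
  assumes conv: "AE x in process_law X K. convergent (time_avg (\<lambda>t. f (x t)))"
  shows "integrable (process_law X K) (\<lambda>x. lim (time_avg (\<lambda>t. f (x t))))"
proof -
  interpret P: prob_space "process_law X K" by (rule prob_space_process_law)
  have comp: "(\<lambda>x. f (x t)) \<in> borel_measurable (process_law X K)" for t
    by (rule measurable_compose[of _ _ "count_space X"]) (auto simp: measurable_cong_sets[OF sets_process_law refl])
  show ?thesis
  proof (rule P.integrable_const_bound)
    let ?B = "\<Sum>y\<in>X. \<bar>f y\<bar>"
    show "AE x in process_law X K. norm (lim (time_avg (\<lambda>t. f (x t)))) \<le> ?B"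
      using conv AE_space
    proof eventually_elim
      case (elim x)
      then have "(\<lambda>T. \<bar>time_avg (\<lambda>t. f (x t)) T\<bar>) \<longlonglongrightarrow> \<bar>lim (time_avg (\<lambda>t. f (x t)))\<bar>"
        by (intro tendsto_rabs) (simp add: convergent_LIMSEQ_iff)
      moreover have "\<bar>time_avg (\<lambda>t. f (x t)) T\<bar> \<le> ?B" for T
        using in_X_process_law[OF elim(2)] by (intro abs_time_avg_le abs_le_sum_abs finite_X)
      ultimately show ?case by (auto intro: LIMSEQ_le_const2)
    qed
    show "(\<lambda>x. lim (time_avg (\<lambda>t. f (x t)))) \<in> borel_measurable (process_law X K)"
      unfolding time_avg_def by (intro borel_measurable_lim_metric borel_measurable_divide borel_measurable_sum comp) simp
  qed
qed

section \<open>Long-run costs of a single player\<close>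

locale controlled_game =
  fixes G :: "('i::finite, 's, 'a) game"
  assumes separately_controlled: "separately_controlled_game G"
begin

abbreviation SA :: "'i \<Rightarrow> ('s \<times> 'a) set" where
  "SA i \<equiv> states G i \<times> actions G i"

abbreviation next_value :: "'i \<Rightarrow> ('s \<Rightarrow> real) \<Rightarrow> 's \<times> 'a \<Rightarrow> real" where
  "next_value i h sa \<equiv> measure_pmf.expectation (transition G i (fst sa) (snd sa)) h"

lemma finite_states: "finite (states G i)"
  and finite_actions: "finite (actions G i)"
  and actions_nonempty: "actions G i \<noteq> {}"
  and init_state: "init G i \<in> states G i"
  and transition_closed: "s \<in> states G i \<Longrightarrow> a \<in> actions G i \<Longrightarrow> set_pmf (transition G i s a) \<subseteq> states G i"
  using separately_controlled unfolding separately_controlled_game_def by auto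

lemma player_history_process:
  assumes "randomized_policy G i v"
  shows "history_process (SA i) (player_step G i v)"
proof
  show "finite (SA i)" using finite_states finite_actions by simp
  fix l assume l: "l \<in> lists (SA i)"
  have "set_pmf (if l = [] then return_pmf (init G i) else transition G i (fst (last l)) (snd (last l))) \<subseteq> states G i"
  proof (cases "l = []")
    case False
    then have "last l \<in> SA i" using l last_in_set[of l] by auto
    then show ?thesis using False transition_closed by (auto simp: mem_Times_iff)
  qed (simp add: init_state)
  moreover have "set_pmf (v (observe G i l) s) \<subseteq> actions G i" if "s \<in> states G i" for s
    using assms l that unfolding randomized_policy_def by blast
  ultimately show "set_pmf (player_step G i v l) \<subseteq> SA i"
    unfolding player_step_def set_bind_pmf by fastforce
qed

lemma stationary_randomized: "d \<in> SD G i \<Longrightarrow> randomized_policy G i (stationary d)"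
  by (auto simp: randomized_policy_def stationary_def SD_def)

text \<open>
  For any function \<open>h\<close> of the state and any policy, however it uses the history, the next state is
  drawn from the transition law of the present state and action.  The increments
  \<open>h (s\<^bsub>t+1\<^esub>) - (P h) (s\<^sub>t, a\<^sub>t)\<close> are therefore bounded martingale differences; replacing \<open>h (s\<^bsub>t+1\<^esub>)\<close> by
  \<open>h (s\<^sub>t)\<close> changes the sum by a bounded boundary term only.
\<close>

lemma defect_averages_vanish:
  assumes v: "randomized_policy G i v"
  shows "AE x in player_law G i v.
    time_avg (\<lambda>t. h (fst (x t)) - next_value i h (x t)) \<longlonglongrightarrow> 0"
proof -
  interpret history_process "SA i" "player_step G i v" by (rule player_history_process[OF v])
  define B where "B = (\<Sum>s\<in>states G i. \<bar>h s\<bar>)"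
  \<comment> \<open>The increment that leads into y.  The initial state has no predecessor, hence the value 0.\<close>
  define F where "F l y = (if l = [] then 0 else h (fst y) - next_value i h (last l))" for l :: "('s \<times> 'a) list" and y :: "'s \<times> 'a"
  have B0: "0 \<le> B" unfolding B_def by (simp add: sum_nonneg)
  have hB: "\<bar>h s\<bar> \<le> B" if "s \<in> states G i" for s
    unfolding B_def using finite_states that by (rule abs_le_sum_abs)
  have nextB: "\<bar>next_value i h sa\<bar> \<le> B" if "sa \<in> SA i" for sa
  proof -
    have "set_pmf (transition G i (fst sa) (snd sa)) \<subseteq> states G i"
      using that by (intro transition_closed) auto
    then show ?thesis
      using finite_states[of i] by (intro abs_expectation_le hB) (auto intro: finite_subset)
  qed
  have last: "last l \<in> SA i" if "l \<in> lists (SA i)" "l \<noteq> []" for l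
    using that last_in_set[of l] by auto
  have bound: "\<bar>F l y\<bar> \<le> 2 * B" if "l \<in> lists (SA i)" "y \<in> SA i" for l y
    using nextB[OF last[OF that(1)]] hB[of "fst y"] that(2) B0 by (auto simp: F_def)
  have mean: "measure_pmf.expectation (player_step G i v l) (F l) = 0" if l: "l \<in> lists (SA i)" for l
  proof (cases "l = []")
    case True
    then show ?thesis by (simp add: F_def[abs_def])
  next
    case False
    have "map_pmf fst (player_step G i v l) = transition G i (fst (last l)) (snd (last l))"
      using False by (simp add: player_step_def map_bind_pmf map_pmf_const bind_return_pmf')
    then have "measure_pmf.expectation (player_step G i v l) (\<lambda>y. h (fst y)) = next_value i h (last l)"
      by (metis integral_map_pmf)
    moreover have "F l = (\<lambda>y. h (fst y) - next_value i h (last l))"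
      using False by (simp add: F_def[abs_def])
    ultimately show ?thesis
      by (simp add: integrable_measure_pmf_finite[OF finite_set_K[OF l]])
  qed
  have "AE x in player_law G i v. (\<lambda>T. (\<Sum>t<T. F (map x [0..<t]) (x t)) / real T) \<longlonglongrightarrow> 0"
    unfolding player_law_def by (rule martingale_difference_slln[OF bound mean])
  moreover have "AE x in player_law G i v. x \<in> space (player_law G i v)" by (rule AE_space)
  ultimately show ?thesis
  proof eventually_elim
    case (elim x)
    have x: "x t \<in> SA i" for t using in_X_process_law elim(2) unfolding player_law_def by blast
    \<comment> \<open>The boundary term left over by telescoping.\<close>
    define e where "e T = (\<Sum>t<T. h (fst (x t)) - next_value i h (x t)) - (\<Sum>t<T. F (map x [0..<t]) (x t))" for T
    have e_Suc: "e (Suc n) = h (fst (x 0)) - next_value i h (x n)" for n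
    proof (induction n)
      case 0
      show ?case by (simp add: e_def F_def)
    next
      case (Suc n)
      have "e (Suc (Suc n)) = e (Suc n) + (h (fst (x (Suc n))) - next_value i h (x (Suc n)))
          - F (map x [0..<Suc n]) (x (Suc n))"
        by (simp add: e_def)
      also have "F (map x [0..<Suc n]) (x (Suc n)) = h (fst (x (Suc n))) - next_value i h (x n)"
        by (simp add: F_def)
      finally show ?case using Suc.IH by simp
    qed
    have "\<bar>e T\<bar> \<le> 2 * B" for T
    proof (cases T)
      case 0
      then show ?thesis using B0 by (simp add: e_def)
    next
      case (Suc n)
      then show ?thesis using e_Suc[of n] nextB[OF x[of n]] hB[of "fst (x 0)"] x[of 0] by auto
    qed
    then have "(\<lambda>T. e T / real T) \<longlonglongrightarrow> 0" by (rule bounded_over_n_tendsto_0)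
    from tendsto_add[OF elim(1) this] show ?case
      by (simp add: e_def time_avg_def[abs_def] flip: add_divide_distrib)
  qed
qed

text \<open>
  Summing the inequality \<open>g + h s - (P h) (s, a) \<le> c s a\<close> along a path bounds the time average of the cost
  from below by \<open>g\<close> plus averages that vanish.
\<close>

lemma optimality_inequality_lower_bound:
  assumes v: "randomized_policy G i v"
    and ineq: "\<And>s a. s \<in> states G i \<Longrightarrow> a \<in> actions G i \<Longrightarrow> g + h s \<le> c s a + next_value i h (s, a)"
  shows "AE x in player_law G i v. convergent (time_avg (\<lambda>t. c (fst (x t)) (snd (x t)))) \<longrightarrow>
    g \<le> lim (time_avg (\<lambda>t. c (fst (x t)) (snd (x t))))"
  using defect_averages_vanish[OF v, of h] AE_space
proof eventually_elim
  case (elim x)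
  interpret history_process "SA i" "player_step G i v" by (rule player_history_process[OF v])
  have x: "x t \<in> SA i" for t using in_X_process_law elim(2) unfolding player_law_def by blast
  let ?D = "\<lambda>t. h (fst (x t)) - next_value i h (x t)" and ?c = "\<lambda>t. c (fst (x t)) (snd (x t))"
  have le: "g + time_avg ?D T \<le> time_avg ?c T" if "T > 0" for T
  proof -
    have "g + ?D t \<le> ?c t" for t
      using ineq[of "fst (x t)" "snd (x t)"] x[of t] by (simp add: mem_Times_iff)
    then have "(\<Sum>t<T. g + ?D t) \<le> (\<Sum>t<T. ?c t)" by (intro sum_mono)
    then have "(real T * g + (\<Sum>t<T. ?D t)) / real T \<le> (\<Sum>t<T. ?c t) / real T"
      by (intro divide_right_mono) (simp_all add: sum.distrib)
    then show ?thesis using that by (simp add: time_avg_def add_divide_distrib)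
  qed
  show ?case
  proof
    assume "convergent (time_avg ?c)"
    then have lim: "time_avg ?c \<longlonglongrightarrow> lim (time_avg ?c)" by (simp add: convergent_LIMSEQ_iff)
    have "(\<lambda>T. g + time_avg ?D T) \<longlonglongrightarrow> g + 0" by (intro tendsto_intros elim(1))
    moreover have "\<exists>N. \<forall>T\<ge>N. g + time_avg ?D T \<le> time_avg ?c T"
      by (intro exI[of _ 1] allI impI le) simp
    ultimately have "g + 0 \<le> lim (time_avg ?c)"
      using LIMSEQ_le[OF _ lim] by blast
    then show "g \<le> lim (time_avg ?c)" by simp
  qed
qed

lemma stationary_follows_rule:
  assumes d: "d \<in> SD G i"
  shows "AE x in player_law G i (stationary d). \<forall>t. snd (x t) = d (fst (x t))"
proof -
  interpret history_process "SA i" "player_step G i (stationary d)"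
    by (rule player_history_process[OF stationary_randomized[OF d]])
  have "AE x in player_law G i (stationary d). snd (x t) = d (fst (x t))" for t
  proof -
    have "AE x in player_law G i (stationary d).
        snd (last (map x [0..<Suc t])) = d (fst (last (map x [0..<Suc t])))"
      unfolding player_law_def
      by (rule AE_prefix) (auto simp: player_step_def stationary_def)
    then show ?thesis by simp
  qed
  then show ?thesis by (simp add: AE_all_countable)
qed

text \<open>
  Along paths that follow \<open>d\<close> the Poisson equation turns the averages of the cost into \<open>g\<close> plus averages
  that vanish.
\<close>

lemma stationary_time_avg_tendsto:
  assumes d: "d \<in> SD G i"
    and eq: "\<And>s. s \<in> states G i \<Longrightarrow> g + h s = c s (d s) + next_value i h (s, d s)"
  shows "AE x in player_law G i (stationary d). time_avg (\<lambda>t. c (fst (x t)) (snd (x t))) \<longlonglongrightarrow> g"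
  using defect_averages_vanish[OF stationary_randomized[OF d], of h] stationary_follows_rule[OF d] AE_space
proof eventually_elim
  case (elim x)
  interpret history_process "SA i" "player_step G i (stationary d)"
    by (rule player_history_process[OF stationary_randomized[OF d]])
  have x: "x t \<in> SA i" for t using in_X_process_law elim(3) unfolding player_law_def by blast
  let ?D = "\<lambda>t. h (fst (x t)) - next_value i h (x t)" and ?c = "\<lambda>t. c (fst (x t)) (snd (x t))"
  have "g + ?D t = ?c t" for t
    using eq[of "fst (x t)"] x[of t] elim(2) by (simp add: mem_Times_iff)
  then have c: "?c = (\<lambda>t. g + ?D t)" by simp
  have "(\<lambda>T. g + time_avg ?D T) \<longlonglongrightarrow> g + 0" by (intro tendsto_intros elim(1))
  then have "(\<lambda>T. g + time_avg ?D T) \<longlonglongrightarrow> g" by simp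
  then show ?case
  proof (rule Lim_transform_eventually)
    show "\<forall>\<^sub>F T in sequentially. g + time_avg ?D T = time_avg ?c T"
      using eventually_gt_at_top[of 0]
      by eventually_elim (simp add: c time_avg_def sum.distrib add_divide_distrib)
  qed
qed

end

section \<open>Marginals of the joint process\<close>

context controlled_game
begin

definition coord :: "'i \<Rightarrow> ('i \<Rightarrow> 's) \<times> ('i \<Rightarrow> 'a) \<Rightarrow> 's \<times> 'a" where
  "coord i z = (fst z i, snd z i)"

abbreviation joint_SA :: "(('i \<Rightarrow> 's) \<times> ('i \<Rightarrow> 'a)) set" where
  "joint_SA \<equiv> {s. \<forall>i. s i \<in> states G i} \<times> {a. \<forall>i. a i \<in> actions G i}"

lemma coord_in_SA: "z \<in> joint_SA \<Longrightarrow> coord i z \<in> SA i"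
  by (auto simp: coord_def)

lemma set_Pi_pmf_UNIV: "f \<in> set_pmf (Pi_pmf UNIV dflt p) \<Longrightarrow> f i \<in> set_pmf (p i)"
  for f :: "'i \<Rightarrow> 'b"
  using set_Pi_pmf_subset'[of UNIV dflt p] by (auto simp: PiE_dflt_def)

lemma Pi_pmf_UNIV_component: "map_pmf (\<lambda>f. f i) (Pi_pmf UNIV dflt p) = p i"
  for p :: "'i \<Rightarrow> 'b pmf"
  by (simp add: Pi_pmf_component)

lemma observe_joint: "map (\<lambda>(s, a). (s i, a i)) l = map (coord i) l"
  by (simp add: coord_def case_prod_beta)

lemma joint_history_process:
  assumes u: "\<And>i. randomized_policy G i (u i)"
  shows "history_process joint_SA (joint_step G u)"
proof
  have "finite (PiE UNIV (states G))" "finite (PiE UNIV (actions G))"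
    by (auto intro!: finite_PiE finite_states finite_actions)
  then show "finite joint_SA" by (auto simp: PiE_UNIV_domain Pi_def)
  fix l assume l: "l \<in> lists joint_SA"
  show "set_pmf (joint_step G u l) \<subseteq> joint_SA"
  proof
    fix y assume "y \<in> set_pmf (joint_step G u l)"
    then obtain s a where y: "y = (s, a)"
      and s: "s \<in> set_pmf (if l = [] then return_pmf (init G)
               else Pi_pmf UNIV undefined (\<lambda>i. transition G i (fst (last l) i) (snd (last l) i)))"
      and a: "a \<in> set_pmf (Pi_pmf UNIV undefined (\<lambda>i. u i (observe G i (map (coord i) l)) (s i)))"
      unfolding joint_step_def observe_joint by auto
    have "s i \<in> states G i" for i
    proof (cases "l = []")
      case True
      then show ?thesis using s init_state by simp
    next
      case False
      then have "last l \<in> joint_SA" using l last_in_set[of l] by auto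
      then have "set_pmf (transition G i (fst (last l) i) (snd (last l) i)) \<subseteq> states G i"
        by (intro transition_closed) auto
      then show ?thesis using s False set_Pi_pmf_UNIV by fastforce
    qed
    moreover have "a i \<in> actions G i" for i
    proof -
      have "map (coord i) l \<in> lists (SA i)"
        using l coord_in_SA unfolding in_lists_conv_set set_map by blast
      then have "set_pmf (u i (observe G i (map (coord i) l)) (s i)) \<subseteq> actions G i"
        using u[of i] \<open>s i \<in> states G i\<close> unfolding randomized_policy_def by blast
      then show ?thesis using set_Pi_pmf_UNIV[OF a, of i] by blast
    qed
    ultimately show "y \<in> joint_SA" by (simp add: y)
  qed
qed

text \<open>
  A step of the joint process draws the coordinates independently, each from data of its own player,
  so projecting to one player gives exactly a step of that player's process.
\<close>

lemma joint_step_coord: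
  "map_pmf (coord i) (joint_step G u l) = player_step G i (u i) (map (coord i) l)"
proof -
  let ?S = "if l = [] then return_pmf (init G)
     else Pi_pmf UNIV undefined (\<lambda>i. transition G i (fst (last l) i) (snd (last l) i))"
  let ?o = "\<lambda>i. observe G i (map (coord i) l)"
  have S: "map_pmf (\<lambda>s. s i) ?S = (if map (coord i) l = [] then return_pmf (init G i)
     else transition G i (fst (last (map (coord i) l))) (snd (last (map (coord i) l))))"
    by (simp add: Pi_pmf_UNIV_component last_map coord_def)
  have "map_pmf (coord i) (joint_step G u l) =
     bind_pmf ?S (\<lambda>s. map_pmf (Pair (s i)) (map_pmf (\<lambda>a. a i) (Pi_pmf UNIV undefined (\<lambda>i. u i (?o i) (s i)))))"
    unfolding joint_step_def observe_joint map_bind_pmf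
    by (simp add: coord_def map_pmf_def bind_assoc_pmf bind_return_pmf)
  also have "\<dots> = bind_pmf ?S (\<lambda>s. map_pmf (Pair (s i)) (u i (?o i) (s i)))"
    by (simp add: Pi_pmf_UNIV_component)
  also have "\<dots> = bind_pmf (map_pmf (\<lambda>s. s i) ?S) (\<lambda>s. map_pmf (Pair s) (u i (?o i) s))"
    by (simp add: bind_map_pmf)
  also have "\<dots> = player_step G i (u i) (map (coord i) l)"
    unfolding S unfolding player_step_def map_pmf_def ..
  finally show ?thesis .
qed

lemma joint_path_coord:
  "map_pmf (map (coord i)) (path_pmf (joint_step G u) n) = path_pmf (player_step G i (u i)) n"
proof (induction n)
  case (Suc n)
  have "map_pmf (map (coord i)) (path_pmf (joint_step G u) (Suc n)) =
    bind_pmf (path_pmf (joint_step G u) n) (\<lambda>l. map_pmf (\<lambda>x. map (coord i) l @ [x]) (map_pmf (coord i) (joint_step G u l)))"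
    by (simp add: map_bind_pmf pmf.map_comp o_def)
  also have "\<dots> = path_pmf (player_step G i (u i)) (Suc n)"
    by (simp add: joint_step_coord bind_map_pmf flip: Suc.IH)
  finally show ?case .
qed simp

text \<open>
  Both laws are determined by their prefixes, whose distributions agree step by step.
\<close>

lemma joint_law_coord:
  assumes u: "\<And>i. randomized_policy G i (u i)"
  shows measurable_coord: "(\<lambda>x t. coord i (x t)) \<in> measurable (joint_law G u) (PiM UNIV (\<lambda>_. count_space (SA i)))"
    and distr_coord: "distr (joint_law G u) (PiM UNIV (\<lambda>_. count_space (SA i))) (\<lambda>x t. coord i (x t)) = player_law G i (u i)"
proof -
  interpret J: history_process joint_SA "joint_step G u" by (rule joint_history_process[OF u])
  interpret P: history_process "SA i" "player_step G i (u i)" by (rule player_history_process[OF u])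
  let ?M = "PiM UNIV (\<lambda>_. count_space (SA i))"
  show meas: "(\<lambda>x t. coord i (x t)) \<in> measurable (joint_law G u) ?M"
    unfolding joint_law_def measurable_cong_sets[OF J.sets_process_law refl]
  proof (rule measurable_PiM_single')
    show "(\<lambda>x. coord i (x t)) \<in> measurable (PiM UNIV (\<lambda>_. count_space joint_SA)) (count_space (SA i))" for t
      by (rule measurable_compose[OF measurable_component_singleton]) (auto simp: coord_def)
  next
    show "(\<lambda>x t. coord i (x t)) \<in> space (PiM UNIV (\<lambda>_. count_space joint_SA)) \<rightarrow> (\<Pi>\<^sub>E t\<in>UNIV. space (count_space (SA i)))"
      unfolding space_PiM space_count_space PiE_UNIV_domain Pi_iff using coord_in_SA by blast
  qed
  show "distr (joint_law G u) ?M (\<lambda>x t. coord i (x t)) = player_law G i (u i)"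
    unfolding player_law_def
  proof (rule P.process_law_eqI)
    fix n
    have "distr (distr (joint_law G u) ?M (\<lambda>x t. coord i (x t))) (count_space UNIV) (\<lambda>x. map x [0..<n]) =
        distr (joint_law G u) (count_space UNIV) (\<lambda>x. map (coord i) (map x [0..<n]))"
      using P.measurable_prefix[of "\<lambda>l. l"] meas by (simp add: distr_distr o_def)
    also have "\<dots> = distr (distr (joint_law G u) (count_space UNIV) (\<lambda>x. map x [0..<n])) (count_space UNIV) (map (coord i))"
      unfolding joint_law_def by (subst distr_distr) (simp_all add: o_def)
    also have "\<dots> = measure_pmf (map_pmf (map (coord i)) (path_pmf (joint_step G u) n))"
      unfolding joint_law_def J.distr_prefix by (simp add: map_pmf_rep_eq)
    finally show "distr (distr (joint_law G u) ?M (\<lambda>x t. coord i (x t))) (count_space UNIV) (\<lambda>x. map x [0..<n]) =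
        path_pmf (player_step G i (u i)) n"
      by (simp only: joint_path_coord)
  qed simp
qed

lemma AE_joint_law_coord:
  assumes u: "\<And>i. randomized_policy G i (u i)" and "AE y in player_law G i (u i). Q y"
  shows "AE x in joint_law G u. Q (\<lambda>t. coord i (x t))"
proof (rule AE_distrD[OF measurable_coord[OF u, of i]])
  show "AE y in distr (joint_law G u) (PiM UNIV (\<lambda>_. count_space (SA i))) (\<lambda>x t. coord i (x t)). Q y"
    unfolding distr_coord[OF u, of i] by (rule assms(2))
qed

lemma HR_randomized: "v \<in> HR G i \<Longrightarrow> randomized_policy G i v"
  by (simp add: HR_def)

lemma AE_joint_HR:
  assumes u: "u \<in> HR_profiles G"
  shows "AE x in joint_law G u. convergent (time_avg (reward_at G i x)) \<and>
     convergent (time_avg (\<lambda>t. (reward_at G i x t)\<^sup>2))"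
proof -
  have conv: "AE y in player_law G i (u i).
     convergent (time_avg (\<lambda>t. reward G i (fst (y t)) (snd (y t)))) \<and>
        convergent (time_avg (\<lambda>t. (reward G i (fst (y t)) (snd (y t)))\<^sup>2))"
    using u by (auto simp: HR_profiles_def HR_def)
  have "randomized_policy G j (u j)" for j
    using u by (simp add: HR_profiles_def HR_randomized)
  from AE_joint_law_coord[OF this conv] show ?thesis
    by (simp add: coord_def reward_at_def[abs_def])
qed

lemma AE_joint_HR_shifted:
  assumes u: "u \<in> HR_profiles G"
  shows "AE x in joint_law G u. time_avg (\<lambda>t. (reward_at G i x t - c)\<^sup>2) \<longlonglongrightarrow>
     lim (time_avg (\<lambda>t. (reward_at G i x t)\<^sup>2)) - 2 * c * lim (time_avg (reward_at G i x)) + c\<^sup>2"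
  using AE_joint_HR[OF u, of i]
  by eventually_elim (auto intro!: time_avg_square_shift simp: convergent_LIMSEQ_iff)

section \<open>The criterion with a fixed centre\<close>

text \<open>
  The team variance with its centre \<open>\<mu>\<^sup>u\<close> replaced by an arbitrary constant: for fixed \<open>c\<close> this is a sum
  of ordinary average costs, one for each player.
\<close>

definition dispersion :: "('i \<Rightarrow> ('s, 'a) policy) \<Rightarrow> real \<Rightarrow> real" where
  "dispersion u c =
     (\<integral>x. (\<Sum>i\<in>UNIV. lim (time_avg (\<lambda>t. (reward_at G i x t - c)\<^sup>2))) \<partial>joint_law G u)"

lemma team_variance_eq_dispersion: "team_variance G u = dispersion u (team_mean G u)"
  by (simp add: team_variance_def dispersion_def)

lemma joint_integrable:
  assumes u: "u \<in> HR_profiles G" and "AE x in joint_law G u. convergent (time_avg (\<lambda>t. f (x t)))"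
  shows "integrable (joint_law G u) (\<lambda>x. lim (time_avg (\<lambda>t. f (x t) :: real)))"
proof -
  interpret J: history_process joint_SA "joint_step G u"
    using u by (intro joint_history_process) (simp add: HR_profiles_def HR_randomized)
  show ?thesis
    using assms(2) unfolding joint_law_def by (rule J.integrable_lim_time_avg)
qed

lemma joint_prob_space: "u \<in> HR_profiles G \<Longrightarrow> prob_space (joint_law G u)"
  unfolding joint_law_def
  by (intro history_process.prob_space_process_law joint_history_process) (simp add: HR_profiles_def HR_randomized)

lemma integrable_shifted:
  assumes u: "u \<in> HR_profiles G"
  shows "integrable (joint_law G u) (\<lambda>x. lim (time_avg (\<lambda>t. (reward_at G i x t - c)\<^sup>2)))"
proof -
  have "AE x in joint_law G u. convergent (time_avg (\<lambda>t. (reward_at G i x t - c)\<^sup>2))"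
    using AE_joint_HR_shifted[OF u, of i c] by eventually_elim (rule convergentI)
  then show ?thesis
    unfolding reward_at_def
    by (rule joint_integrable[OF u, of "\<lambda>z. (reward G i (fst z i) (snd z i) - c)\<^sup>2"])
qed

text \<open>
  The parallel axis theorem for the team criterion.  The cross term is governed by
  \<open>\<Sum>\<^sub>i m\<^sub>i = n \<mu>\<^sup>u\<close>, where \<open>m\<^sub>i\<close> is the expected long-run average reward of player \<open>i\<close>.
\<close>

lemma dispersion_eq:
  assumes u: "u \<in> HR_profiles G"
  shows "dispersion u c = team_variance G u + real CARD('i) * (c - team_mean G u)\<^sup>2"
proof -
  interpret P: prob_space "joint_law G u" by (rule joint_prob_space[OF u])
  let ?n = "real CARD('i)"
  define m where "m i x = lim (time_avg (reward_at G i x))" for i x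
  define q where "q i x = lim (time_avg (\<lambda>t. (reward_at G i x t)\<^sup>2))" for i x
  have int_m: "integrable (joint_law G u) (m i)" for i
    using AE_joint_HR[OF u, of i] unfolding m_def reward_at_def[abs_def]
    by (intro joint_integrable[OF u, of "\<lambda>z. reward G i (fst z i) (snd z i)"]) auto
  have int_q: "integrable (joint_law G u) (q i)" for i
    using integrable_shifted[OF u, of i 0] unfolding q_def by simp
  define M where "M = (\<Sum>i\<in>UNIV. \<integral>x. m i x \<partial>joint_law G u)"
  define Q where "Q = (\<Sum>i\<in>UNIV. \<integral>x. q i x \<partial>joint_law G u)"
  have mean: "M = ?n * team_mean G u"
    unfolding team_mean_def m_def[symmetric] M_def by (simp add: int_m integral_sum)
  have disp: "dispersion u b = Q - 2 * b * M + ?n * b\<^sup>2" for b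
  proof -
    have "(\<integral>x. lim (time_avg (\<lambda>t. (reward_at G i x t - b)\<^sup>2)) \<partial>joint_law G u) =
        (\<integral>x. q i x \<partial>joint_law G u) - 2 * b * (\<integral>x. m i x \<partial>joint_law G u) + b\<^sup>2" for i
    proof -
      have "AE x in joint_law G u. lim (time_avg (\<lambda>t. (reward_at G i x t - b)\<^sup>2)) = q i x - 2 * b * m i x + b\<^sup>2"
        using AE_joint_HR_shifted[OF u, of i b] by eventually_elim (simp add: q_def m_def limI)
      then have "(\<integral>x. lim (time_avg (\<lambda>t. (reward_at G i x t - b)\<^sup>2)) \<partial>joint_law G u) =
          (\<integral>x. q i x - 2 * b * m i x + b\<^sup>2 \<partial>joint_law G u)"
        using integrable_shifted[OF u, of i b] int_m[of i] int_q[of i]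
        by (intro integral_cong_AE borel_measurable_integrable) auto
      then show ?thesis using int_m[of i] int_q[of i] by (simp add: P.prob_space)
    qed
    then show ?thesis
      unfolding dispersion_def
      by (simp add: integrable_shifted[OF u] sum.distrib sum_subtractf M_def Q_def sum_distrib_left)
  qed
  show ?thesis
    unfolding team_variance_eq_dispersion disp mean by (simp add: power2_eq_square algebra_simps)
qed

end

section \<open>Optimal stationary profiles\<close>

locale ergodic_controlled_game = controlled_game G for G :: "('i::finite, 's, 'a) game" +
  assumes ergodic: "ergodic_game G"
begin

lemma stationary_chain:
  assumes "d \<in> SD G i"
  shows "irreducible_finite_chain (states G i) (\<lambda>s. transition G i s (d s))"
proof
  show "set_pmf (transition G i s (d s)) \<subseteq> states G i" if "s \<in> states G i" for s
    using assms that by (intro transition_closed) (auto simp: SD_def)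
  show "irreducible_chain (states G i) (\<lambda>s. transition G i s (d s))"
    using ergodic assms by (auto simp: ergodic_game_def ergodic_chain_def)
qed (use finite_states init_state in blast)+

text \<open>
  Convergence of the averages of the reward and of its square follows from the Poisson equations with these
  two functions as costs.
\<close>

lemma stationary_in_HR:
  assumes d: "d \<in> SD G i"
  shows "stationary d \<in> HR G i"
proof -
  interpret irreducible_finite_chain "states G i" "\<lambda>s. transition G i s (d s)"
    by (rule stationary_chain[OF d])
  have conv: "AE x in player_law G i (stationary d). convergent (time_avg (\<lambda>t. c (fst (x t)) (snd (x t))))"
    for c :: "'s \<Rightarrow> 'a \<Rightarrow> real"
  proof -
    obtain g h where gh: "\<forall>s\<in>states G i. g + h s = c s (d s) + measure_pmf.expectation (transition G i s (d s)) h"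
      using poisson_equation[of "\<lambda>s. c s (d s)"] by blast
    have "AE x in player_law G i (stationary d). time_avg (\<lambda>t. c (fst (x t)) (snd (x t))) \<longlonglongrightarrow> g"
      by (rule stationary_time_avg_tendsto[OF d, of g h c]) (use gh in simp)
    then show ?thesis by eventually_elim (rule convergentI)
  qed
  show ?thesis
    using conv[of "reward G i"] conv[of "\<lambda>s a. (reward G i s a)\<^sup>2"] stationary_randomized[OF d]
    unfolding HR_def by simp
qed

text \<open>
  The criterion with fixed centre splits over the players, and player \<open>i\<close>'s share is bounded below by
  the optimal gain \<open>g\<^sub>i\<close> of the cost \<open>(r\<^sub>i - c)\<^sup>2\<close>; the optimal stationary rules attain all bounds at once.
\<close>

lemma stationary_dispersion_minimal:
  "\<exists>d. (\<forall>i. d i \<in> SD G i) \<and>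
     (\<forall>u\<in>HR_profiles G. dispersion (\<lambda>i. stationary (d i)) c \<le> dispersion u c)"
proof -
  define cost where "cost i s a = (reward G i s a - c)\<^sup>2" for i s a
  define optimal where "optimal i d g h \<longleftrightarrow> d \<in> SD G i \<and>
    (\<forall>s\<in>states G i. g + h s = cost i s (d s) + next_value i h (s, d s)) \<and>
    (\<forall>s\<in>states G i. \<forall>a\<in>actions G i. g + h s \<le> cost i s a + next_value i h (s, a))" for i d g h
  have "\<exists>d g h. optimal i d g h" for i
    using average_cost_optimality[of "states G i" "actions G i" "transition G i" "cost i"]
      stationary_chain[of _ i] finite_states[of i] finite_actions[of i] actions_nonempty[of i]
    unfolding SD_def optimal_def fst_conv snd_conv by blast
  then obtain d g h where opt: "\<And>i. optimal i (d i) (g i) (h i)" by metis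
  have d: "d i \<in> SD G i" for i using opt by (simp add: optimal_def)
  have eq: "g i + h i s = cost i s (d i s) + next_value i (h i) (s, d i s)" if "s \<in> states G i" for i s
    using opt[of i] that by (simp add: optimal_def)
  have ineq: "g i + h i s \<le> cost i s a + next_value i (h i) (s, a)"
    if "s \<in> states G i" "a \<in> actions G i" for i s a
    using opt[of i] that unfolding optimal_def by blast
  let ?L = "\<lambda>i x. lim (time_avg (\<lambda>t. (reward_at G i x t - c)\<^sup>2))"
  have lower: "(\<Sum>i\<in>UNIV. g i) \<le> dispersion u c" if u: "u \<in> HR_profiles G" for u
  proof -
    interpret P: prob_space "joint_law G u" by (rule joint_prob_space[OF u])
    have rp: "randomized_policy G i (u i)" for i using u by (simp add: HR_profiles_def HR_randomized)
    have "g i \<le> (\<integral>x. ?L i x \<partial>joint_law G u)" for i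
    proof (rule P.integral_ge_const[OF integrable_shifted[OF u]])
      from AE_joint_law_coord[OF rp optimality_inequality_lower_bound[OF rp ineq]]
      have "AE x in joint_law G u. convergent (time_avg (\<lambda>t. (reward_at G i x t - c)\<^sup>2)) \<longrightarrow> g i \<le> ?L i x"
        by (simp add: coord_def cost_def reward_at_def)
      with AE_joint_HR_shifted[OF u, of i c] show "AE x in joint_law G u. g i \<le> ?L i x"
        by eventually_elim (auto intro: convergentI)
    qed
    then show ?thesis
      unfolding dispersion_def by (simp add: integrable_shifted[OF u] sum_mono)
  qed
  let ?u = "\<lambda>i. stationary (d i)"
  have u: "?u \<in> HR_profiles G" using d by (simp add: HR_profiles_def stationary_in_HR)
  interpret P: prob_space "joint_law G ?u" by (rule joint_prob_space[OF u])
  have "(\<integral>x. ?L i x \<partial>joint_law G ?u) \<le> g i" for i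
  proof (rule P.integral_le_const[OF integrable_shifted[OF u]])
    have "AE y in player_law G i (?u i). time_avg (\<lambda>t. cost i (fst (y t)) (snd (y t))) \<longlonglongrightarrow> g i"
      using stationary_time_avg_tendsto[OF d, of i "g i" "h i" "cost i"] eq[of _ i] by blast
    from AE_joint_law_coord[OF stationary_randomized[OF d] this]
    show "AE x in joint_law G ?u. ?L i x \<le> g i"
      by eventually_elim (simp add: coord_def cost_def reward_at_def limI)
  qed
  then have upper: "dispersion ?u c \<le> (\<Sum>i\<in>UNIV. g i)"
    unfolding dispersion_def by (simp add: integrable_shifted[OF u] sum_mono)
  show ?thesis using d lower upper by (meson order_trans)
qed

text \<open>
  Any admissible profile \<open>u\<close> is beaten by a stationary one, via the dispersion centred at the mean of
  \<open>u\<close>, and among the finitely many stationary ones a best exists.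
\<close>

theorem stationary_minimizer:
  "\<exists>d. (\<forall>i. d i \<in> SD G i) \<and> (\<lambda>i. stationary (d i)) \<in> HR_profiles G \<and>
     (\<forall>u\<in>HR_profiles G. team_variance G (\<lambda>i. stationary (d i)) \<le> team_variance G u)"
proof -
  let ?J = "\<lambda>d. team_variance G (\<lambda>i. stationary (d i))" and ?D = "PiE UNIV (SD G)"
  have D: "d \<in> ?D \<longleftrightarrow> (\<forall>i. d i \<in> SD G i)" for d by auto
  have HR: "(\<lambda>i. stationary (d i)) \<in> HR_profiles G" if "d \<in> ?D" for d
    using that by (simp add: HR_profiles_def stationary_in_HR D)
  have fin: "finite ?D"
    unfolding SD_def by (intro finite_PiE finite finite_states finite_actions)
  have ne: "?D \<noteq> {}"
    unfolding SD_def by (simp add: PiE_eq_empty_iff actions_nonempty)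
  have "Min (?J ` ?D) \<in> ?J ` ?D" using fin ne by (intro Min_in) auto
  then obtain d where d: "d \<in> ?D" and "?J d = Min (?J ` ?D)" by auto
  then have min: "?J d \<le> ?J e" if "e \<in> ?D" for e using that fin by simp
  have "?J d \<le> team_variance G u" if u: "u \<in> HR_profiles G" for u
  proof -
    obtain e where e: "e \<in> ?D"
      and le: "dispersion (\<lambda>i. stationary (e i)) (team_mean G u) \<le> dispersion u (team_mean G u)"
      using stationary_dispersion_minimal[of "team_mean G u"] u D by blast
    have "?J d \<le> ?J e" by (rule min[OF e])
    \<comment> \<open>The mean of u is in general the wrong centre for e, which can only increase the dispersion.\<close>
    also have "\<dots> \<le> dispersion (\<lambda>i. stationary (e i)) (team_mean G u)"
      unfolding dispersion_eq[OF HR[OF e]] by simp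
    also note le
    finally show ?thesis by (simp only: team_variance_eq_dispersion)
  qed
  then show ?thesis using d HR[OF d] D by blast
qed

end

theorem theorem2:
  fixes G :: "('i::finite, 's, 'a) game"
  assumes "separately_controlled_game G"
    and "ergodic_game G"
  shows "\<exists>d. (\<forall>i. d i \<in> SD G i) \<and>
    (let u = (\<lambda>i. stationary (d i)) in
       u \<in> HR_profiles G \<and>
       (\<forall>u'\<in>HR_profiles G. team_variance G u \<le> team_variance G u') \<and>
       nash_equilibrium G u)"
proof -
  interpret ergodic_controlled_game G
    using assms by unfold_locales
  obtain d where d: "\<forall>i. d i \<in> SD G i" and HR: "(\<lambda>i. stationary (d i)) \<in> HR_profiles G"
    and min: "\<forall>u\<in>HR_profiles G. team_variance G (\<lambda>i. stationary (d i)) \<le> team_variance G u"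
    using stationary_minimizer by blast
  have "nash_equilibrium G (\<lambda>i. stationary (d i))"
    unfolding nash_equilibrium_def
  proof (intro conjI HR allI ballI)
    fix i v assume "v \<in> HR G i"
    then have "(\<lambda>i. stationary (d i))(i := v) \<in> HR_profiles G"
      using HR by (simp add: HR_profiles_def)
    then show "team_variance G (\<lambda>i. stationary (d i)) \<le> team_variance G ((\<lambda>i. stationary (d i))(i := v))"
      using min by blast
  qed
  then show ?thesis using d HR min unfolding Let_def by blast
qed

end
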